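(* Let $u\le v$ in $S_n$ and let $I$ be a strong hypercube decomposition of $[u,v]$. (i) If there exists a reflection order satisfying (E1), then $\widetilde{R}_{u,v}\le\widetilde{H}_{u,v,I}$. (ii) If there exists a reflection order satisfying (E2), then $\widetilde{R}_{u,v}\ge\widetilde{H}_{u,v,I}$. (iii) If there exists a reflection order satisfying (E), then $\widetilde{R}_{u,v}=\widetilde{H}_{u,v,I}$. Here polynomials are compared coefficientwise.
   Context: $S_n$ is the symmetric group with simple reflections $s_i=(i\ i{+}1)$, length $\ell$, $\ell(u,v)=\ell(v)-\ell(u)$, and $T$ the set of transpositions. The Bruhat graph $\Gamma$ has vertex set $S_n$ and edges $w\xrightarrow{t}tw$ labelled $t$ whenever $t\in T$, $\ell(w)<\ell(tw)$; Bruhat order is reachability; $\Gamma(u,v)$ is the induced subgraph on $[u,v]$. A diamond is a subgraph of $\Gamma$ with four distinct vertices $x_1,x_2,x_3,x_4$ and edges $x_1\to x_2\to x_4$, $x_1\to x_3\to x_4$; a set $X\subset[u,v]$ is diamond-closed in $[u,v]$ if whenever $X$ contains three vertices of a diamond contained in $[u,v]$ it contains the fourth. $R$-polynomials: $R_{u,v}=0$ if $u\not\le v$, $R_{v,v}=1$, $R_{u,v}=R_{us,vs}$ if $s\in\mathrm{Des}(u)\cap\mathrm{Des}(v)$, $R_{u,v}=qR_{us,vs}+(q-1)R_{u,vs}$ if $s\in\mathrm{Des}(v)\setminus\mathrm{Des}(u)$, where $\mathrm{Des}(w)=\{s_i: ws_i<w\}$. $\widetilde{R}_{u,v}(q)\in\mathbb{N}[q]$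 is the unique polynomial with $R_{u,v}(q)=q^{\ell(u,v)/2}\widetilde{R}_{u,v}(q^{1/2}-q^{-1/2})$. For an order ideal $I\subset[u,v]$ and $x\in I$, let $\mathcal{Y}_x=\{y\in[u,v]\setminus I: x\to y\}$ and $\mathcal{A}_x$ the set of Bruhat antichains contained in $\mathcal{Y}_x$, with $Y_1\to Y_2$ iff $Y_1\subset Y_2$, $|Y_2\setminus Y_1|=1$. A strong hypercube cluster at $x$ relative to $I$ is a map $\theta_x:\mathcal{A}_x\to[u,v]$ with (HC1) $\theta_x(\varnothing)=x$; (HC2) $\theta_x(\{y\})=y$ for $y\in\mathcal{Y}_x$; (HC3) $Y_1\to Y_2$ implies $\theta_x(Y_1)\to\theta_x(Y_2)$ in $\Gamma$; (HC4) if $|Y|=|Y'|=|Y\cap Y'|+1$ and $\theta_x(Y\cap Y'),\theta_x(Y),\theta_x(Y'),w$ form a diamond in $\Gamma(u,v)$ with top $w$, then $Y\cup Y'$ is an antichain and $\theta_x(Y\cup Y')=w$. A strong hypercube decomposition of $[u,v]$ is an order ideal $I$ with (HD1) $I=[u,z]$ for some $z\in[u,v]$; (HD2) $I$ diamond-closed in $[u,v]$; (HD3) every $x\in I$ has a strong hypercube cluster $\theta_x$ relative to $I$. Define $\widetilde{H}_{u,v,I}(q)=\sum_{x\in I}\sum_{Y\in\mathcal{A}_x,\ \theta_x(Y)=v}q^{|Y|}\widetilde{R}_{u,x}(q)$. A reflection order is a total order $\prec$ on $T$ with, for all $a<b<c$, either $(a\,b)\prec(a\,c)\prec(b\,c)$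 or $(b\,c)\prec(a\,c)\prec(a\,b)$. Conditions relative to $I$: (E1) for $x\in I$, if $x\xrightarrow{t_1}y_1$, $x\xrightarrow{t_2}y_2$ with $y_1\in I$, $y_2\in[u,v]\setminus I$, then $t_1\prec t_2$; (E2) for $x\in I$, if $y_1\xrightarrow{t_1}x$ and $x\xrightarrow{t_2}y_2$ with $y_1\in I$, $y_2\in[u,v]\setminus I$, then $t_1\prec t_2$; (E) if $x_1\xrightarrow{t}x_2$ with $x_1,x_2\in I$ and $x\xrightarrow{t'}y$ with $x\in I$, $y\in[u,v]\setminus I$, then $t\prec t'$. *)

theory Defs
  imports Complex_Main "HOL-Combinatorics.Permutations" "HOL-Computational_Algebra.Polynomial"
begin

(* Permutations of {1..n}, as functions nat => nat; product uw = u o w. *)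
type_synonym perm = "nat \<Rightarrow> nat"

definition Sn :: "nat \<Rightarrow> perm set" where
  "Sn n = {w. w permutes {1..n}}"

definition len :: "nat \<Rightarrow> perm \<Rightarrow> nat" where
  "len n w = card {(i, j). i \<in> {1..n} \<and> j \<in> {1..n} \<and> i < j \<and> w i > w j}"

definition sref :: "nat \<Rightarrow> perm" where
  "sref i = Transposition.transpose i (Suc i)"

definition Trans :: "nat \<Rightarrow> perm set" where
  "Trans n = {Transposition.transpose a b | a b. a \<in> {1..n} \<and> b \<in> {1..n} \<and> a < b}"

definition bedge :: "nat \<Rightarrow> perm \<Rightarrow> perm \<Rightarrow> perm \<Rightarrow> bool" where
  "bedge n w t w' \<longleftrightarrow> w \<in> Sn n \<and> t \<in> Trans n \<and> w' = t \<circ> w \<and> len n w < len n w'"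

definition bedge' :: "nat \<Rightarrow> perm \<Rightarrow> perm \<Rightarrow> bool" where
  "bedge' n w w' \<longleftrightarrow> (\<exists>t. bedge n w t w')"

definition bruhat_le :: "nat \<Rightarrow> perm \<Rightarrow> perm \<Rightarrow> bool" where
  "bruhat_le n u v \<longleftrightarrow> u \<in> Sn n \<and> (bedge' n)\<^sup>*\<^sup>* u v"

definition bruhat_less :: "nat \<Rightarrow> perm \<Rightarrow> perm \<Rightarrow> bool" where
  "bruhat_less n u v \<longleftrightarrow> bruhat_le n u v \<and> u \<noteq> v"

definition interval :: "nat \<Rightarrow> perm \<Rightarrow> perm \<Rightarrow> perm set" where
  "interval n u v = {w. bruhat_le n u w \<and> bruhat_le n w v}"

definition Des :: "nat \<Rightarrow> perm \<Rightarrow> nat set" where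
  "Des n w = {i. 1 \<le> i \<and> i < n \<and> bruhat_less n (w \<circ> sref i) w}"

(* R-polynomials, by the defining recursion, always using the smallest right descent of v.
   The fuel argument k is the length of v. *)
primrec Rfuel :: "nat \<Rightarrow> nat \<Rightarrow> perm \<Rightarrow> perm \<Rightarrow> int poly" where
  "Rfuel n 0 u v = (if bruhat_le n u v \<and> u = v then 1 else 0)"
| "Rfuel n (Suc k) u v =
     (if \<not> bruhat_le n u v then 0
      else if u = v then 1
      else (let s = sref (Min (Des n v)) in
            if Min (Des n v) \<in> Des n u then Rfuel n k (u \<circ> s) (v \<circ> s)
            else [:0, 1:] * Rfuel n k (u \<circ> s) (v \<circ> s) + [:-1, 1:] * Rfuel n k u (v \<circ> s)))"

definition Rpoly :: "nat \<Rightarrow> perm \<Rightarrow> perm \<Rightarrow> int poly" where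
  "Rpoly n u v = Rfuel n (len n v) u v"

definition Rtilde :: "nat \<Rightarrow> perm \<Rightarrow> perm \<Rightarrow> int poly" where
  "Rtilde n u v = (THE p. \<forall>q::real. q > 0 \<longrightarrow>
      poly (map_poly of_int (Rpoly n u v)) q =
      q powr ((real (len n v) - real (len n u)) / 2) * poly (map_poly of_int p) (sqrt q - 1 / sqrt q))"

definition diamond :: "nat \<Rightarrow> perm \<Rightarrow> perm \<Rightarrow> perm \<Rightarrow> perm \<Rightarrow> bool" where
  "diamond n x1 x2 x3 x4 \<longleftrightarrow> distinct [x1, x2, x3, x4] \<and>
     bedge' n x1 x2 \<and> bedge' n x2 x4 \<and> bedge' n x1 x3 \<and> bedge' n x3 x4"

definition diamond_closed :: "nat \<Rightarrow> perm \<Rightarrow> perm \<Rightarrow> perm set \<Rightarrow> bool" where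
  "diamond_closed n u v X \<longleftrightarrow> X \<subseteq> interval n u v \<and>
     (\<forall>x1 x2 x3 x4. diamond n x1 x2 x3 x4 \<and> {x1, x2, x3, x4} \<subseteq> interval n u v \<and>
        card ({x1, x2, x3, x4} \<inter> X) \<ge> 3 \<longrightarrow> {x1, x2, x3, x4} \<subseteq> X)"

definition order_ideal :: "nat \<Rightarrow> perm \<Rightarrow> perm \<Rightarrow> perm set \<Rightarrow> bool" where
  "order_ideal n u v I \<longleftrightarrow> I \<subseteq> interval n u v \<and>
     (\<forall>x y. x \<in> I \<and> y \<in> interval n u v \<and> bruhat_le n y x \<longrightarrow> y \<in> I)"

definition Yset :: "nat \<Rightarrow> perm \<Rightarrow> perm \<Rightarrow> perm set \<Rightarrow> perm \<Rightarrow> perm set" where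
  "Yset n u v I x = {y \<in> interval n u v - I. bedge' n x y}"

definition antichain :: "nat \<Rightarrow> perm set \<Rightarrow> bool" where
  "antichain n Y \<longleftrightarrow> (\<forall>a\<in>Y. \<forall>b\<in>Y. bruhat_le n a b \<longrightarrow> a = b)"

definition Aset :: "nat \<Rightarrow> perm \<Rightarrow> perm \<Rightarrow> perm set \<Rightarrow> perm \<Rightarrow> perm set set" where
  "Aset n u v I x = {Y. Y \<subseteq> Yset n u v I x \<and> antichain n Y}"

definition strong_hc_cluster ::
  "nat \<Rightarrow> perm \<Rightarrow> perm \<Rightarrow> perm set \<Rightarrow> perm \<Rightarrow> (perm set \<Rightarrow> perm) \<Rightarrow> bool" where
  "strong_hc_cluster n u v I x th \<longleftrightarrow>
     (\<forall>Y \<in> Aset n u v I x. th Y \<in> interval n u v) \<and>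
     th {} = x \<and>
     (\<forall>y \<in> Yset n u v I x. th {y} = y) \<and>
     (\<forall>Y1 \<in> Aset n u v I x. \<forall>Y2 \<in> Aset n u v I x.
        Y1 \<subset> Y2 \<and> card (Y2 - Y1) = 1 \<longrightarrow> bedge' n (th Y1) (th Y2)) \<and>
     (\<forall>Y \<in> Aset n u v I x. \<forall>Y' \<in> Aset n u v I x. \<forall>w.
        card Y = card Y' \<and> card Y = card (Y \<inter> Y') + 1 \<and>
        diamond n (th (Y \<inter> Y')) (th Y) (th Y') w \<and>
        {th (Y \<inter> Y'), th Y, th Y', w} \<subseteq> interval n u v
        \<longrightarrow> antichain n (Y \<union> Y') \<and> th (Y \<union> Y') = w)"

definition strong_hc_decomp :: "nat \<Rightarrow> perm \<Rightarrow> perm \<Rightarrow> perm set \<Rightarrow> bool" where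
  "strong_hc_decomp n u v I \<longleftrightarrow> order_ideal n u v I \<and>
     (\<exists>z \<in> interval n u v. I = interval n u z) \<and>
     diamond_closed n u v I \<and>
     (\<forall>x \<in> I. \<exists>th. strong_hc_cluster n u v I x th)"

definition Htilde ::
  "nat \<Rightarrow> perm \<Rightarrow> perm \<Rightarrow> perm set \<Rightarrow> (perm \<Rightarrow> perm set \<Rightarrow> perm) \<Rightarrow> int poly" where
  "Htilde n u v I th = (\<Sum>x\<in>I. \<Sum>Y\<in>{Y \<in> Aset n u v I x. th x Y = v}.
       monom 1 (card Y) * Rtilde n u x)"

definition reflection_order :: "nat \<Rightarrow> (perm \<Rightarrow> perm \<Rightarrow> bool) \<Rightarrow> bool" where
  "reflection_order n prec \<longleftrightarrow>
     (\<forall>t \<in> Trans n. \<not> prec t t) \<and>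
     (\<forall>t1 \<in> Trans n. \<forall>t2 \<in> Trans n. \<forall>t3 \<in> Trans n. prec t1 t2 \<and> prec t2 t3 \<longrightarrow> prec t1 t3) \<and>
     (\<forall>t1 \<in> Trans n. \<forall>t2 \<in> Trans n. t1 \<noteq> t2 \<longrightarrow> prec t1 t2 \<or> prec t2 t1) \<and>
     (\<forall>a b c. 1 \<le> a \<and> a < b \<and> b < c \<and> c \<le> n \<longrightarrow>
        (prec (Transposition.transpose a b) (Transposition.transpose a c) \<and>
         prec (Transposition.transpose a c) (Transposition.transpose b c)) \<or>
        (prec (Transposition.transpose b c) (Transposition.transpose a c) \<and>
         prec (Transposition.transpose a c) (Transposition.transpose a b)))"

definition condE1 :: "nat \<Rightarrow> perm \<Rightarrow> perm \<Rightarrow> perm set \<Rightarrow> (perm \<Rightarrow> perm \<Rightarrow> bool) \<Rightarrow> bool" where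
  "condE1 n u v I prec \<longleftrightarrow> (\<forall>x t1 y1 t2 y2. x \<in> I \<and> bedge n x t1 y1 \<and> bedge n x t2 y2 \<and>
      y1 \<in> I \<and> y2 \<in> interval n u v - I \<longrightarrow> prec t1 t2)"

definition condE2 :: "nat \<Rightarrow> perm \<Rightarrow> perm \<Rightarrow> perm set \<Rightarrow> (perm \<Rightarrow> perm \<Rightarrow> bool) \<Rightarrow> bool" where
  "condE2 n u v I prec \<longleftrightarrow> (\<forall>x t1 y1 t2 y2. x \<in> I \<and> bedge n y1 t1 x \<and> bedge n x t2 y2 \<and>
      y1 \<in> I \<and> y2 \<in> interval n u v - I \<longrightarrow> prec t1 t2)"

definition condE :: "nat \<Rightarrow> perm \<Rightarrow> perm \<Rightarrow> perm set \<Rightarrow> (perm \<Rightarrow> perm \<Rightarrow> bool) \<Rightarrow> bool" where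
  "condE n u v I prec \<longleftrightarrow> (\<forall>x1 t x2 x t' y. x1 \<in> I \<and> x2 \<in> I \<and> bedge n x1 t x2 \<and>
      x \<in> I \<and> bedge n x t' y \<and> y \<in> interval n u v - I \<longrightarrow> prec t t')"

definition poly_le :: "int poly \<Rightarrow> int poly \<Rightarrow> bool" where
  "poly_le p q \<longleftrightarrow> (\<forall>i. coeff p i \<le> coeff q i)"

end

theory Submission
  imports Defs
begin

text \<open>
  By Dyer's formula, \<open>R\<close>-tilde counts the paths with increasing labels for any reflection order. An
  increasing path from \<open>u\<close> to \<open>v\<close> is cut at its last vertex \<open>x\<close> in \<open>I\<close>. Every
  two-step path lies in a unique diamond, one side of which is increasing and starts with the
  smaller and ends with the larger label. Hence each antichain \<open>Y\<close> carries exactly one increasing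
  path among the images of the maximal chains of subsets of \<open>Y\<close>, so that the triples counted by
  \<open>H\<close>-tilde are pairs of an increasing path from \<open>u\<close> to \<open>x\<close> and one from \<open>x\<close> to \<open>v\<close> of this kind.
  Under (E1) every increasing path that leaves \<open>I\<close> at \<open>x\<close> is of this kind; under (E2) the
  concatenation of the two paths is increasing.
\<close>

section \<open>Length and edges of the Bruhat graph\<close>

text \<open>The obstacle in Dyer's formula is that \<open>Rpoly\<close> recurses by multiplying
  \<open>sref i\<close> on the right, while path labels act on the left, so increasing paths for
  \<open>u\<close>, \<open>v\<close> and for \<open>u \<circ> sref i\<close>,
  \<open>v \<circ> sref i\<close> are not directly comparable. The recursion is therefore embedded
  in a family of identities indexed by the initial sections \<open>J\<close> of the reflection
  order: at \<open>J = {}\<close> the identity is trivial, at \<open>J = Trans n\<close> it is the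
  recursion, and enlarging \<open>J\<close> by one reflection adds one explicit term to each path
  polynomial. A cluster map is not assumed injective. The arguments use only that two one-element
  extensions of the same set have different images, which follows from the uniqueness of diamonds.
  Uniqueness and the comparison of labels rest on one computation: the product of two distinct
  transpositions is either a product of disjoint ones, with two factorizations, or a 3-cycle, with
  three. In the second case the ascent conditions admit exactly one factorization besides the given
  one.\<close>

definition inversions :: "nat \<Rightarrow> perm \<Rightarrow> (nat \<times> nat) set" where
  "inversions n w = {(i, j). i \<in> {1..n} \<and> j \<in> {1..n} \<and> i < j \<and> w i > w j}"

lemma finite_inversions: "finite (inversions n w)"
  by (rule finite_subset[of _ "{1..n} \<times> {1..n}"]) (auto simp: inversions_def)

lemma len_eq_card_inversions: "len n w = card (inversions n w)"
  by (simp add: len_def inversions_def)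

text \<open>Inversions of \<open>w\<close> inject into those of the product: a pair of positions is
  transported by the transposition if it stays in order, and is kept otherwise. The pair
  \<open>(i, j)\<close> is a new inversion that the injection misses, so the inequality is
  strict.\<close>

lemma len_swap_positions:
  assumes "1 \<le> i" "i < j" "j \<le> n" "w i < w j"
  shows "len n w < len n (w \<circ> transpose i j)"
proof -
  let ?t = "transpose i j"
  define \<phi> where "\<phi> = (\<lambda>(k, l). if ?t k < ?t l then (?t k, ?t l) else (k, l))"
  have inj: "inj_on \<phi> (inversions n w)"
  proof (rule inj_onI, clarify)
    fix k l k' l'
    assume kl: "(k, l) \<in> inversions n w" "(k', l') \<in> inversions n w" and eq: "\<phi> (k, l) = \<phi> (k', l')"
    have "k < l" "k' < l'" using kl by (auto simp: inversions_def)
    then show "k = k' \<and> l = l'"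
      using eq unfolding \<phi>_def by (auto split: if_splits dest: transpose_eq_imp_eq)
  qed
  have "\<phi> ` inversions n w \<subseteq> inversions n (w \<circ> ?t) - {(i, j)}"
  proof (rule image_subsetI, clarify)
    fix k l assume "(k, l) \<in> inversions n w"
    then have kl: "1 \<le> k" "l \<le> n" "k < l" "w l < w k" by (auto simp: inversions_def)
    show "\<phi> (k, l) \<in> inversions n (w \<circ> ?t) - {(i, j)}"
    proof (cases "?t k < ?t l")
      case True
      moreover have "?t k \<in> {1..n}" "?t l \<in> {1..n}"
        using kl assms by (auto simp: transpose_def)
      moreover have "(?t k, ?t l) \<noteq> (i, j)"
        using kl assms by (auto simp: transpose_eq_iff)
      ultimately show ?thesis using kl by (auto simp: \<phi>_def inversions_def)
    next
      case False
      then consider "k = i" "i < l" "l < j" | "l = j" "i < k" "k < j" | "k = i" "l = j"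
        using kl assms(2) by (auto simp: transpose_def split: if_splits)
      then show ?thesis using False kl assms
        by cases (auto simp: \<phi>_def inversions_def)
    qed
  qed
  moreover have "(i, j) \<in> inversions n (w \<circ> ?t)"
    using assms by (auto simp: inversions_def)
  ultimately have "\<phi> ` inversions n w \<subset> inversions n (w \<circ> ?t)" by blast
  then have "card (\<phi> ` inversions n w) < card (inversions n (w \<circ> ?t))"
    by (rule psubset_card_mono[OF finite_inversions])
  then show ?thesis using card_image[OF inj] by (simp add: len_eq_card_inversions)
qed

text \<open>No position lies between \<open>i\<close> and \<open>Suc i\<close>, so the transposition
  keeps every other pair of positions in order and carries inversions to inversions; only the
  swapped pair itself is added.\<close>

lemma len_swap_adjacent:
  assumes "1 \<le> i" "i < n" "w i < w (Suc i)"
  shows "len n (w \<circ> sref i) = Suc (len n w)"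
proof -
  let ?t = "transpose i (Suc i)"
  let ?f = "map_prod ?t ?t"
  have "inversions n (w \<circ> ?t) = insert (i, Suc i) (?f ` inversions n w)"
  proof (intro equalityI subsetI)
    fix p assume p: "p \<in> inversions n (w \<circ> ?t)"
    obtain k l where kl: "p = (k, l)" by (cases p)
    show "p \<in> insert (i, Suc i) (?f ` inversions n w)"
    proof (cases "p = (i, Suc i)")
      case False
      then have "?t k < ?t l" using p kl by (auto simp: inversions_def transpose_def split: if_splits)
      then have "(?t k, ?t l) \<in> inversions n w"
        using p kl assms by (auto simp: inversions_def transpose_def split: if_splits)
      then have "?f (?t k, ?t l) \<in> ?f ` inversions n w" by (rule imageI)
      then show ?thesis by (simp add: kl)
    qed simp
  next
    fix p assume "p \<in> insert (i, Suc i) (?f ` inversions n w)"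
    then show "p \<in> inversions n (w \<circ> ?t)"
      using assms by (auto simp: inversions_def transpose_def split: if_splits)
  qed
  moreover have "(i, Suc i) \<notin> ?f ` inversions n w"
    using assms by (auto simp: inversions_def transpose_def split: if_splits)
  moreover have "inj ?f" by (intro prod.inj_map) auto
  ultimately show ?thesis
    by (simp add: len_eq_card_inversions sref_def finite_inversions card_image inj_on_subset)
qed

section \<open>Edges of the Bruhat graph in terms of the positions of values\<close>

lemma Sn_comp: "u \<in> Sn n \<Longrightarrow> w \<in> Sn n \<Longrightarrow> u \<circ> w \<in> Sn n"
  by (simp add: Sn_def permutes_compose)

lemma transpose_in_Sn: "a \<in> {1..n} \<Longrightarrow> b \<in> {1..n} \<Longrightarrow> transpose a b \<in> Sn n"
  by (simp add: Sn_def permutes_swap_id)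

lemma sref_in_Sn: "1 \<le> i \<Longrightarrow> i < n \<Longrightarrow> sref i \<in> Sn n"
  by (simp add: sref_def transpose_in_Sn)

lemma sref_sref [simp]: "w \<circ> sref i \<circ> sref i = w"
  by (simp add: sref_def fun_eq_iff)

lemma sref_apply [simp]: "sref i i = Suc i" "sref i (Suc i) = i"
  by (simp_all add: sref_def)

lemma Sn_bij: "w \<in> Sn n \<Longrightarrow> bij w"
  by (simp add: Sn_def permutes_bij)

lemma Sn_inv_in: "w \<in> Sn n \<Longrightarrow> a \<in> {1..n} \<Longrightarrow> inv w a \<in> {1..n}"
  using permutes_in_image[OF permutes_inv, of w "{1..n}" a] by (simp add: Sn_def)

lemma Sn_in: "w \<in> Sn n \<Longrightarrow> a \<in> {1..n} \<Longrightarrow> w a \<in> {1..n}"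
  using permutes_in_image[of w "{1..n}" a] by (simp add: Sn_def)

lemma inv_transpose_comp:
  assumes "bij w" shows "inv (transpose a b \<circ> w) c = inv w (transpose a b c)"
  using assms by (simp add: o_inv_distrib)

lemma finite_Sn: "finite (Sn n)"
  by (simp add: Sn_def finite_permutations)

lemma TransE:
  assumes "t \<in> Trans n"
  obtains a b where "a \<in> {1..n}" "b \<in> {1..n}" "a < b" "t = transpose a b"
  using assms unfolding Trans_def by blast

lemma transpose_in_Trans: "a \<in> {1..n} \<Longrightarrow> b \<in> {1..n} \<Longrightarrow> a \<noteq> b \<Longrightarrow> transpose a b \<in> Trans n"
  unfolding Trans_def using transpose_commute[of a b] by (cases "a < b") (blast, force)

lemma Trans_in_Sn: "t \<in> Trans n \<Longrightarrow> t \<in> Sn n"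
  by (elim TransE) (simp add: transpose_in_Sn)

lemma Trans_involution: "t \<in> Trans n \<Longrightarrow> t \<circ> (t \<circ> w) = w"
  by (elim TransE) (simp add: fun_eq_iff)

lemma finite_Trans: "finite (Trans n)"
  by (rule finite_subset[OF _ finite_Sn[of n]]) (auto intro: Trans_in_Sn)

lemma len_transpose_comp:
  assumes w: "w \<in> Sn n" and a: "a \<in> {1..n}" and b: "b \<in> {1..n}" and "a < b" "inv w a < inv w b"
  shows "len n w < len n (transpose a b \<circ> w)"
proof -
  have bij: "bij w" using w by (rule Sn_bij)
  have "transpose a b \<circ> w = w \<circ> transpose (inv w a) (inv w b)"
    using bij by (rule transpose_comp_eq)
  moreover have "w (inv w a) = a" "w (inv w b) = b"
    using bij by (simp_all add: bij_is_surj surj_f_inv_f)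
  ultimately show ?thesis
    using len_swap_positions[of "inv w a" "inv w b" n w] Sn_inv_in[OF w a] Sn_inv_in[OF w b] assms
    by simp
qed

text \<open>The criterion is symmetric in \<open>a\<close> and \<open>b\<close>, so that later case
  analyses may name the two values in any order, in particular let \<open>a\<close> be a value
  shared by two labels.\<close>

lemma bedge_transpose_iff:
  assumes w: "w \<in> Sn n" and a: "a \<in> {1..n}" and b: "b \<in> {1..n}" and ne: "a \<noteq> b"
  shows "bedge n w (transpose a b) w' \<longleftrightarrow>
    w' = transpose a b \<circ> w \<and> (a < b \<longleftrightarrow> inv w a < inv w b)"
proof -
  have main: "len n w < len n (transpose a b \<circ> w) \<longleftrightarrow> inv w a < inv w b"
    if ab: "a < b" and ab': "a \<in> {1..n}" "b \<in> {1..n}" for a b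
  proof (cases "inv w a < inv w b")
    case True
    then show ?thesis using len_transpose_comp[OF w] that by simp
  next
    case False
    let ?w = "transpose a b \<circ> w"
    have bij: "bij w" using w by (rule Sn_bij)
    have "inv w a \<noteq> inv w b" using ab bij
      by (metis bij_inv_eq_iff nat_neq_iff)
    then have "inv ?w a < inv ?w b" using False bij by (simp add: inv_transpose_comp)
    moreover have "?w \<in> Sn n" by (intro Sn_comp transpose_in_Sn ab' w)
    ultimately have "len n ?w < len n (transpose a b \<circ> ?w)"
      using len_transpose_comp ab ab' by blast
    moreover have "transpose a b \<circ> ?w = w" by (simp add: fun_eq_iff)
    ultimately show ?thesis using False by simp
  qed
  have "inv w a \<noteq> inv w b" using ne Sn_bij[OF w] by (metis bij_inv_eq_iff)
  then have "len n w < len n (transpose a b \<circ> w) \<longleftrightarrow> (a < b \<longleftrightarrow> inv w a < inv w b)"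
    using main[of a b] main[of b a] a b ne
    by (cases "a < b") (auto simp: transpose_commute[of a b])
  then show ?thesis
    using w transpose_in_Trans[OF a b ne] by (auto simp: bedge_def)
qed

lemma bedgeE:
  assumes "bedge n w t w'"
  obtains a b where "a \<in> {1..n}" "b \<in> {1..n}" "a \<noteq> b" "t = transpose a b" "w' = t \<circ> w"
    "a < b \<longleftrightarrow> inv w a < inv w b"
proof -
  from assms have w: "w \<in> Sn n" and "t \<in> Trans n" by (auto simp: bedge_def)
  from this(2) obtain a b where ab: "a \<in> {1..n}" "b \<in> {1..n}" "a < b" "t = transpose a b"
    by (rule TransE)
  then show ?thesis using assms bedge_transpose_iff[OF w ab(1,2)] that[OF ab(1,2) _ ab(4)] by auto
qed

lemma bedge_Sn: "bedge n w t w' \<Longrightarrow> w \<in> Sn n" "bedge n w t w' \<Longrightarrow> w' \<in> Sn n"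
  by (auto simp: bedge_def intro: Sn_comp Trans_in_Sn)

lemma bedge_label_unique:
  assumes "bedge n w t w'" "bedge n w t' w'" shows "t = t'"
proof -
  have "t \<circ> w = t' \<circ> w" "surj w"
    using assms by (auto simp: bedge_def dest: Sn_bij bij_is_surj)
  then show ?thesis by (metis comp_def surjD ext)
qed

lemma bruhat_le_Sn: "bruhat_le n u v \<Longrightarrow> u \<in> Sn n" "bruhat_le n u v \<Longrightarrow> v \<in> Sn n"
proof -
  assume uv: "bruhat_le n u v"
  then show "u \<in> Sn n" by (simp add: bruhat_le_def)
  from uv have "(bedge' n)\<^sup>*\<^sup>* u v" by (simp add: bruhat_le_def)
  then show "v \<in> Sn n" using \<open>u \<in> Sn n\<close>
    by induction (auto simp: bedge'_def intro: bedge_Sn)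
qed

lemma bruhat_le_trans: "bruhat_le n u v \<Longrightarrow> bruhat_le n v w \<Longrightarrow> bruhat_le n u w"
  by (auto simp: bruhat_le_def)

lemma bruhat_le_refl: "u \<in> Sn n \<Longrightarrow> bruhat_le n u u"
  by (simp add: bruhat_le_def)

lemma bedge_bruhat_le: "bedge n u t v \<Longrightarrow> bruhat_le n u v"
  by (auto simp: bruhat_le_def bedge'_def bedge_def intro!: r_into_rtranclp)

lemma bruhat_le_len:
  assumes "bruhat_le n u v" shows "u = v \<or> len n u < len n v"
proof -
  from assms have "(bedge' n)\<^sup>*\<^sup>* u v" by (simp add: bruhat_le_def)
  then show ?thesis by induction (auto simp: bedge'_def bedge_def)
qed

section \<open>Right multiplication by simple reflections, and descents\<close>

lemma comp_sref_eq:
  assumes "w \<in> Sn n"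
  shows "w \<circ> sref i = transpose (w i) (w (Suc i)) \<circ> w"
  using transpose_comp_eq[OF Sn_bij[OF assms], of "w i" "w (Suc i)"] Sn_bij[OF assms]
  by (simp add: sref_def bij_is_inj)

lemma Des_iff:
  assumes w: "w \<in> Sn n" and i: "1 \<le> i" "i < n"
  shows "i \<in> Des n w \<longleftrightarrow> w (Suc i) < w i"
proof
  assume "w (Suc i) < w i"
  let ?v = "w \<circ> sref i" and ?t = "transpose (w i) (w (Suc i))"
  have bij: "bij w" using w by (rule Sn_bij)
  have "?v \<in> Sn n" using w i by (simp add: Sn_comp sref_in_Sn)
  have "?v i < ?v (Suc i)" using \<open>w (Suc i) < w i\<close> by (simp add: sref_def)
  then have l: "len n ?v < len n w" using len_swap_adjacent[OF i, of ?v] by simp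
  have "w = ?t \<circ> ?v"
    unfolding comp_sref_eq[OF w] by (simp add: fun_eq_iff)
  moreover have "?t \<in> Trans n"
    using Sn_in[OF w, of i] Sn_in[OF w, of "Suc i"] i \<open>w (Suc i) < w i\<close>
    by (intro transpose_in_Trans) auto
  ultimately have "bedge n ?v ?t w" using l \<open>?v \<in> Sn n\<close> by (auto simp: bedge_def)
  then show "i \<in> Des n w" using i l bedge_bruhat_le by (auto simp: Des_def bruhat_less_def)
next
  assume "i \<in> Des n w"
  then have "len n (w \<circ> sref i) < len n w"
    using bruhat_le_len by (auto simp: Des_def bruhat_less_def)
  moreover have "w i \<noteq> w (Suc i)" using Sn_bij[OF w] by (simp add: bij_def inj_eq)
  ultimately show "w (Suc i) < w i" using len_swap_adjacent[OF i, of w] by force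
qed

lemma finite_Des: "finite (Des n w)"
  by (rule finite_subset[of _ "{..<n}"]) (auto simp: Des_def)

lemma Des_nonempty:
  assumes w: "w \<in> Sn n" and "len n w > 0"
  shows "Des n w \<noteq> {}"
proof
  assume "Des n w = {}"
  then have step: "w i \<le> w (Suc i)" if "1 \<le> i" "i < n" for i
    using Des_iff[OF w that] by auto
  have mono: "w i \<le> w j" if "i \<le> j" "1 \<le> i" "j \<le> n" for i j
    using that(1,3) that(2) by (induction j rule: dec_induct) (force intro: order_trans[OF _ step])+
  have "inversions n w = {}"
  proof (rule equals0I)
    fix p assume "p \<in> inversions n w"
    then obtain i j where "1 \<le> i" "i < j" "j \<le> n" "w j < w i" by (auto simp: inversions_def)
    then show False using mono[of i j] by simp
  qed
  then show False using assms by (simp add: len_eq_card_inversions)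
qed

section \<open>Generating functions of increasing paths\<close>

text \<open>A path is encoded by its labels alone, since they and the start determine all vertices;
  cutting and joining paths becomes splitting and appending lists.\<close>

primrec walk :: "nat \<Rightarrow> perm \<Rightarrow> perm list \<Rightarrow> perm \<Rightarrow> bool" where
  "walk n u [] v \<longleftrightarrow> u = v"
| "walk n u (t # ts) v \<longleftrightarrow> bedge n u t (t \<circ> u) \<and> walk n (t \<circ> u) ts v"

lemma walk_append: "walk n u (ts @ ts') v \<longleftrightarrow> (\<exists>w. walk n u ts w \<and> walk n w ts' v)"
  by (induction ts arbitrary: u) auto

lemma walk_snoc: "walk n u (ts @ [t]) v \<longleftrightarrow> (\<exists>w. walk n u ts w \<and> bedge n w t v)"
  by (auto simp: walk_append bedge_def)

lemma walk_Trans: "walk n u ts v \<Longrightarrow> set ts \<subseteq> Trans n"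
  by (induction ts arbitrary: u) (auto simp: bedge_def)

lemma walk_deterministic: "walk n u ts v \<Longrightarrow> walk n u ts v' \<Longrightarrow> v = v'"
  by (induction ts arbitrary: u) auto

lemma walk_bruhat_le: "u \<in> Sn n \<Longrightarrow> walk n u ts v \<Longrightarrow> bruhat_le n u v"
  by (induction ts arbitrary: u)
    (auto intro: bruhat_le_refl bruhat_le_trans dest: bedge_bruhat_le bedge_Sn)

lemma walk_loop: "walk n u ts u \<Longrightarrow> ts = []"
proof (cases ts)
  case (Cons t ts')
  assume "walk n u ts u"
  then have t: "bedge n u t (t \<circ> u)" and "walk n (t \<circ> u) ts' u" using Cons by auto
  then have "bruhat_le n (t \<circ> u) u" using walk_bruhat_le bedge_Sn by blast
  then show ?thesis using bruhat_le_len t by (fastforce simp: bedge_def)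
qed

text \<open>The set \<open>J\<close> of admissible labels is a parameter for the sake of an
  induction: only \<open>J = Trans n\<close> occurs in Dyer's formula, but the recursion is proved
  by adding one reflection at a time.\<close>

definition increasing_walks ::
  "nat \<Rightarrow> (perm \<Rightarrow> perm \<Rightarrow> bool) \<Rightarrow> perm set \<Rightarrow> perm \<Rightarrow> perm \<Rightarrow> perm list set" where
  "increasing_walks n prec J u v = {ts. set ts \<subseteq> J \<and> sorted_wrt prec ts \<and> walk n u ts v}"

definition walk_poly ::
  "nat \<Rightarrow> (perm \<Rightarrow> perm \<Rightarrow> bool) \<Rightarrow> perm set \<Rightarrow> perm \<Rightarrow> perm \<Rightarrow> int poly" where
  "walk_poly n prec J u v = (\<Sum>ts\<in>increasing_walks n prec J u v. monom 1 (length ts))"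

locale refl_order =
  fixes n :: nat and prec :: "perm \<Rightarrow> perm \<Rightarrow> bool"
  assumes reflection_order: "reflection_order n prec"
begin

lemma prec_irrefl: "t \<in> Trans n \<Longrightarrow> \<not> prec t t"
  using reflection_order by (simp add: reflection_order_def)

lemma prec_trans:
  "prec t1 t2 \<Longrightarrow> prec t2 t3 \<Longrightarrow> t1 \<in> Trans n \<Longrightarrow> t2 \<in> Trans n \<Longrightarrow> t3 \<in> Trans n \<Longrightarrow> prec t1 t3"
  using reflection_order unfolding reflection_order_def by blast

lemma prec_total: "t1 \<in> Trans n \<Longrightarrow> t2 \<in> Trans n \<Longrightarrow> t1 \<noteq> t2 \<Longrightarrow> prec t1 t2 \<or> prec t2 t1"
  using reflection_order unfolding reflection_order_def by blast

lemma prec_asym: "prec t1 t2 \<Longrightarrow> t1 \<in> Trans n \<Longrightarrow> t2 \<in> Trans n \<Longrightarrow> \<not> prec t2 t1"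
  using prec_irrefl prec_trans by blast

lemma ex_prec_max:
  assumes "finite A" "A \<noteq> {}" "A \<subseteq> Trans n"
  shows "\<exists>t\<in>A. \<forall>t'\<in>A. t' \<noteq> t \<longrightarrow> prec t' t"
  using assms
proof (induction rule: finite_ne_induct)
  case (insert r A)
  then obtain t where t: "t \<in> A" "\<And>t'. t' \<in> A \<Longrightarrow> t' \<noteq> t \<Longrightarrow> prec t' t" by auto
  have T: "r \<in> Trans n" "t \<in> Trans n" "r \<noteq> t" using insert t(1) by auto
  show ?case
  proof (cases "prec r t")
    case True
    then show ?thesis using t by (intro bexI[of _ t]) auto
  next
    case False
    then have tr: "prec t r" using prec_total T by blast
    have "prec t' r" if "t' \<in> A" for t'
      using prec_trans[OF t(2)[OF that] tr] T insert.prems that tr by (cases "t' = t") auto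
    then show ?thesis by (intro bexI[of _ r]) auto
  qed
qed auto

lemma betweenness:
  assumes "1 \<le> a" "a < b" "b < c" "c \<le> n"
  shows "prec (transpose a b) (transpose a c) \<and> prec (transpose a c) (transpose b c) \<or>
    prec (transpose b c) (transpose a c) \<and> prec (transpose a c) (transpose a b)"
  using reflection_order assms unfolding reflection_order_def by blast

lemma increasing_walks_distinct:
  assumes "ts \<in> increasing_walks n prec J u v" shows "distinct ts"
proof -
  have "sorted_wrt prec ts" "set ts \<subseteq> Trans n"
    using assms walk_Trans[of n u ts v] by (simp_all add: increasing_walks_def)
  then show ?thesis using prec_irrefl by (induction ts) auto
qed

lemma finite_increasing_walks: "finite (increasing_walks n prec J u v)"
proof (rule finite_subset)
  show "increasing_walks n prec J u v \<subseteq> {ts. set ts \<subseteq> Trans n \<and> distinct ts}"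
  proof
    fix ts assume ts: "ts \<in> increasing_walks n prec J u v"
    then have "walk n u ts v" by (simp add: increasing_walks_def)
    then show "ts \<in> {ts. set ts \<subseteq> Trans n \<and> distinct ts}"
      using walk_Trans increasing_walks_distinct[OF ts] by simp
  qed
  show "finite {ts. set ts \<subseteq> Trans n \<and> distinct ts}"
    by (rule finite_subset_distinct[OF finite_Trans])
qed

lemma walk_poly_empty: "walk_poly n prec {} u v = (if u = v then 1 else 0)"
proof -
  have "increasing_walks n prec {} u v = (if u = v then {[]} else {})"
    by (auto simp: increasing_walks_def)
  then show ?thesis by (simp add: walk_poly_def)
qed

lemma walk_poly_same: "walk_poly n prec J u u = 1"
proof -
  have "increasing_walks n prec J u u = {[]}"
    using walk_loop by (auto simp: increasing_walks_def)
  then show ?thesis by (simp add: walk_poly_def)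
qed

lemma walk_poly_not_le:
  assumes "u \<in> Sn n" "\<not> bruhat_le n u v" shows "walk_poly n prec J u v = 0"
proof -
  have "increasing_walks n prec J u v = {}"
    using assms walk_bruhat_le by (auto simp: increasing_walks_def)
  then show ?thesis by (simp add: walk_poly_def)
qed

text \<open>A label above all of \<open>J\<close> can occur in an increasing list only once and only
  at the end.\<close>

lemma increasing_walks_insert:
  assumes J: "J \<subseteq> Trans n" and t: "t \<in> Trans n" "t \<notin> J" and max: "\<And>t'. t' \<in> J \<Longrightarrow> prec t' t"
  shows "increasing_walks n prec (insert t J) u y = increasing_walks n prec J u y \<union>
    (if bedge n (t \<circ> y) t y then (\<lambda>ts. ts @ [t]) ` increasing_walks n prec J u (t \<circ> y) else {})"
    (is "?L = ?R")
proof (intro equalityI subsetI)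
  fix ts assume "ts \<in> ?L"
  then have ts: "set ts \<subseteq> insert t J" "sorted_wrt prec ts" "walk n u ts y"
    by (auto simp: increasing_walks_def)
  show "ts \<in> ?R"
  proof (cases "t \<in> set ts")
    case False
    then show ?thesis using ts by (auto simp: increasing_walks_def)
  next
    case True
    then obtain ts1 ts2 where split: "ts = ts1 @ t # ts2" by (meson split_list)
    have "ts2 = []"
    proof (rule ccontr)
      assume "ts2 \<noteq> []"
      then obtain t' where "t' \<in> set ts2" by (cases ts2) auto
      then have "prec t t'" "t' \<in> insert t J" using ts split by (auto simp: sorted_wrt_append)
      then show False using max prec_asym prec_irrefl t J by blast
    qed
    then have eq: "ts = ts1 @ [t]" using split by simp
    then obtain w where w: "walk n u ts1 w" "bedge n w t y" using ts(3) by (auto simp: walk_snoc)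
    then have "w = t \<circ> y" using Trans_involution[OF t(1), of w] by (auto simp: bedge_def)
    moreover have "set ts1 \<subseteq> J"
      using ts eq prec_irrefl[OF t(1)] by (fastforce simp: sorted_wrt_append)
    moreover have "sorted_wrt prec ts1" using ts eq by (simp add: sorted_wrt_append)
    ultimately show ?thesis using w eq by (auto simp: increasing_walks_def)
  qed
next
  fix ts assume "ts \<in> ?R"
  then show "ts \<in> ?L"
    using max
    by (auto simp: increasing_walks_def sorted_wrt_append walk_snoc subset_iff split: if_splits)
qed

lemma walk_poly_insert:
  assumes J: "J \<subseteq> Trans n" and t: "t \<in> Trans n" "t \<notin> J" and max: "\<And>t'. t' \<in> J \<Longrightarrow> prec t' t"
  shows "walk_poly n prec (insert t J) u y = walk_poly n prec J u y +
    (if bedge n (t \<circ> y) t y then monom 1 1 * walk_poly n prec J u (t \<circ> y) else 0)"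
proof (cases "bedge n (t \<circ> y) t y")
  case True
  have "walk_poly n prec (insert t J) u y = walk_poly n prec J u y +
     (\<Sum>ts\<in>(\<lambda>ts. ts @ [t]) ` increasing_walks n prec J u (t \<circ> y). monom 1 (length ts))"
  proof -
    have "increasing_walks n prec J u y \<inter> (\<lambda>ts. ts @ [t]) ` increasing_walks n prec J u (t \<circ> y) = {}"
      using t(2) by (auto simp: increasing_walks_def)
    moreover have "increasing_walks n prec (insert t J) u y = increasing_walks n prec J u y \<union>
        (\<lambda>ts. ts @ [t]) ` increasing_walks n prec J u (t \<circ> y)"
      using increasing_walks_insert[OF assms] True by simp
    ultimately show ?thesis
      unfolding walk_poly_def by (simp add: sum.union_disjoint finite_increasing_walks)
  qed
  also have "(\<Sum>ts\<in>(\<lambda>ts. ts @ [t]) ` increasing_walks n prec J u (t \<circ> y). monom 1 (length ts)) =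
     monom 1 1 * walk_poly n prec J u (t \<circ> y)"
    by (simp add: sum.reindex inj_on_def walk_poly_def sum_distrib_left mult_monom)
  finally show ?thesis using True by simp
next
  case False
  then show ?thesis by (simp add: walk_poly_def increasing_walks_insert[OF assms])
qed

text \<open>Only pairs with exactly one value in \<open>{a, b}\<close> are affected; let
  \<open>q\<close> be the other value. If \<open>q\<close> lies outside the range from
  \<open>a\<close> to \<open>b\<close>, the triangle axiom puts \<open>transpose a q\<close> and
  \<open>transpose b q\<close> on the same side of \<open>transpose a b\<close>, and
  \<open>q\<close> compares equally with \<open>a\<close> and \<open>b\<close>. If \<open>q\<close>
  lies between them, both the membership in \<open>J\<close> and the comparison flip. Membership of
  \<open>transpose a b\<close> itself is left open.\<close>

lemma initial_section_rotate:
  assumes ab: "a \<in> {1..n}" "b \<in> {1..n}" "a < b" and pq: "p \<in> {1..n}" "q \<in> {1..n}" "p \<noteq> q"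
    and ne: "transpose p q \<noteq> transpose a b"
    and J: "\<And>r. r \<in> Trans n \<Longrightarrow> r \<noteq> transpose a b \<Longrightarrow> r \<in> J \<longleftrightarrow> prec r (transpose a b)"
  defines "t \<equiv> transpose a b"
  shows "(t q < t p \<longleftrightarrow> transpose (t p) (t q) \<in> J) \<longleftrightarrow> (q < p \<longleftrightarrow> transpose p q \<in> J)"
proof -
  have key: "(t q < t p \<longleftrightarrow> transpose (t p) (t q) \<in> J) \<longleftrightarrow> (q < p \<longleftrightarrow> transpose p q \<in> J)"
    if p: "p \<in> {a, b}" and q: "q \<notin> {a, b}" "q \<in> {1..n}" for p q
  proof -
    have aq: "transpose a q \<in> J \<longleftrightarrow> prec (transpose a q) (transpose a b)"
      using that ab by (intro J transpose_in_Trans) (auto simp: fun_eq_iff transpose_def)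
    have bq: "transpose b q \<in> J \<longleftrightarrow> prec (transpose b q) (transpose a b)"
      using that ab by (intro J transpose_in_Trans)
        (auto simp: fun_eq_iff transpose_def intro!: exI[of _ q])
    have T: "transpose a q \<in> Trans n" "transpose b q \<in> Trans n" "transpose a b \<in> Trans n"
      using that ab by (auto intro!: transpose_in_Trans)
    have as: "prec (transpose a b) (transpose a q) \<Longrightarrow> \<not> prec (transpose a q) (transpose a b)"
      "prec (transpose a b) (transpose b q) \<Longrightarrow> \<not> prec (transpose b q) (transpose a b)"
      using prec_asym T by blast+
    have tr: "prec (transpose a q) (transpose b q) \<Longrightarrow> prec (transpose b q) (transpose a b) \<Longrightarrow>
        prec (transpose a q) (transpose a b)"
      "prec (transpose b q) (transpose a q) \<Longrightarrow> prec (transpose a q) (transpose a b) \<Longrightarrow>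
        prec (transpose b q) (transpose a b)"
      "prec (transpose a b) (transpose b q) \<Longrightarrow> prec (transpose b q) (transpose a q) \<Longrightarrow>
        prec (transpose a b) (transpose a q)"
      "prec (transpose a b) (transpose a q) \<Longrightarrow> prec (transpose a q) (transpose b q) \<Longrightarrow>
        prec (transpose a b) (transpose b q)"
      using prec_trans T by blast+
    have swap: "transpose q a = transpose a q" "transpose q b = transpose b q"
      by (simp_all add: transpose_commute)
    have tab: "t a = b" "t b = a" "t q = q" using q by (auto simp: t_def)
    consider "q < a" | "a < q" "q < b" | "b < q" using q by fastforce
    then show ?thesis
    proof cases
      case 1
      then show ?thesis using betweenness[of q a b] p q ab as aq bq
        unfolding swap by (elim insertE emptyE) (simp_all add: tab, (blast intro: tr)+)
    next
      case 2
      then show ?thesis using betweenness[of a q b] p q ab as aq bq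
        unfolding swap by (elim insertE emptyE) (simp_all add: tab, (blast intro: tr)+)
    next
      case 3
      then show ?thesis using betweenness[of a b q] p q ab as aq bq
        unfolding swap by (elim insertE emptyE) (simp_all add: tab, (blast intro: tr)+)
    qed
  qed
  have "p \<noteq> q \<Longrightarrow> t p \<noteq> t q" by (auto simp: t_def dest: transpose_eq_imp_eq)
  then have lt: "t p < t q \<longleftrightarrow> \<not> t q < t p" "p < q \<longleftrightarrow> \<not> q < p" using pq by auto
  consider "p \<in> {a, b}" "q \<notin> {a, b}" | "q \<in> {a, b}" "p \<notin> {a, b}" | "p \<notin> {a, b}" "q \<notin> {a, b}"
    using ne pq(3) transpose_commute by fastforce
  then show ?thesis
  proof cases
    case 1
    then show ?thesis using key pq by blast
  next
    case 2
    then show ?thesis using key[of q p] pq lt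
      by (simp add: transpose_commute[of "t q"] transpose_commute[of q]) blast
  next
    case 3
    then show ?thesis by (simp add: t_def)
  qed
qed

lemma bedge_down_iff:
  assumes y: "y \<in> Sn n" and ab: "a \<in> {1..n}" "b \<in> {1..n}" "a < b"
  shows "bedge n (transpose a b \<circ> y) (transpose a b) y \<longleftrightarrow> inv y b < inv y a"
proof -
  have "transpose a b \<circ> y \<in> Sn n" by (intro Sn_comp transpose_in_Sn ab y)
  from bedge_transpose_iff[OF this ab(1,2)] show ?thesis
    using ab Trans_involution[OF transpose_in_Trans[OF ab(1,2)], of y]
    by (simp add: inv_transpose_comp Sn_bij[OF y])
qed

text \<open>
  The path-generating function intertwines two actions of a simple reflection of the Hecke algebra
  up to the initial section \<open>J\<close>: adding the next reflection to \<open>J\<close> preserves the identity,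
  the triangle axiom of reflection orders being used in \<open>initial_section_rotate\<close>.
\<close>

lemma walk_poly_right_mult_initial:
  assumes i: "1 \<le> i" "i < n" and u: "u \<in> Sn n"
  shows "J \<subseteq> Trans n \<Longrightarrow> (\<And>t t'. t \<in> J \<Longrightarrow> t' \<in> Trans n \<Longrightarrow> prec t' t \<Longrightarrow> t' \<in> J) \<Longrightarrow> y \<in> Sn n \<Longrightarrow>
    walk_poly n prec J (u \<circ> sref i) y
      + (if u i < u (Suc i) then monom 1 1 else 0) * walk_poly n prec J u y =
    walk_poly n prec J u (y \<circ> sref i)
      + (if y (Suc i) < y i \<longleftrightarrow> transpose (y i) (y (Suc i)) \<in> J
         then monom 1 1 else 0) * walk_poly n prec J u y"
proof (induction "card J" arbitrary: J y)
  case 0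
  then have "J = {}" using finite_subset[OF _ finite_Trans] by auto
  have gen: "A + (if P then q else 0) * W = B + (if Q then q else 0) * W"
    if "A = B" "D \<Longrightarrow> P = Q" "W = (if D then 1 else 0)"
    for A B W q :: "int poly" and P Q D using that by (cases D) simp_all
  have "u \<circ> sref i = y \<longleftrightarrow> u = y \<circ> sref i" using sref_sref by metis
  then have "walk_poly n prec J (u \<circ> sref i) y = walk_poly n prec J u (y \<circ> sref i)"
    unfolding \<open>J = {}\<close> walk_poly_empty by presburger
  \<comment> \<open>With \<open>J\<close> empty, the coefficient on the right is nonzero exactly
    when \<open>y\<close> ascends at \<open>i\<close>. It has to match the one on the left only for
    \<open>u = y\<close>, as the factor vanishes otherwise.\<close>
  moreover have "y i \<noteq> y (Suc i)" using Sn_bij[OF 0(4)] by (simp add: bij_def inj_eq)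
  then have "u = y \<Longrightarrow> u i < u (Suc i) \<longleftrightarrow> (y (Suc i) < y i \<longleftrightarrow> transpose (y i) (y (Suc i)) \<in> J)"
    unfolding \<open>J = {}\<close> by auto
  moreover have "walk_poly n prec J u y = (if u = y then 1 else 0)"
    unfolding \<open>J = {}\<close> by (rule walk_poly_empty)
  ultimately show ?case by (rule gen)
next
  case (Suc k)
  have fin: "finite J" using finite_subset[OF Suc.prems(1) finite_Trans] .
  have "J \<noteq> {}" using Suc.hyps(2) by auto
  then obtain t where t: "t \<in> J" "\<And>t'. t' \<in> J \<Longrightarrow> t' \<noteq> t \<Longrightarrow> prec t' t"
    using ex_prec_max[OF fin _ Suc.prems(1)] by blast
  have tT: "t \<in> Trans n" using t(1) Suc.prems(1) by blast
  define K where "K = J - {t}"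
  have J: "J = insert t K" and tK: "t \<notin> K" and KT: "K \<subseteq> Trans n"
    using t Suc.prems(1) by (auto simp: K_def)
  have max: "prec t' t" if "t' \<in> K" for t'
    using t(2)[of t'] that by (simp add: K_def)
  have cardK: "k = card K" using Suc.hyps(2) t(1) fin by (simp add: K_def)
  have initK: "t' \<in> K" if "r \<in> K" "t' \<in> Trans n" "prec t' r" for r t'
  proof -
    have "t' \<in> J" using Suc.prems(2)[of r t'] that J by blast
    moreover have "t' \<noteq> t" using prec_asym[OF that(3)] that max[OF that(1)] KT by blast
    ultimately show ?thesis by (simp add: K_def)
  qed
  obtain a b where ab: "a \<in> {1..n}" "b \<in> {1..n}" "a < b" and t_eq: "t = transpose a b"
    using tT by (rule TransE)
  note y = \<open>y \<in> Sn n\<close>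
  have y': "t \<circ> y \<in> Sn n" "y \<circ> sref i \<in> Sn n"
    using Sn_comp[OF Trans_in_Sn[OF tT] y] Sn_comp[OF y sref_in_Sn[OF i]] .
  have inj: "inj y" using Sn_bij[OF y] by (rule bij_is_inj)
  let ?W = "\<lambda>u y. walk_poly n prec K u y" and ?q = "monom 1 1 :: int poly"
  let ?e = "if u i < u (Suc i) then ?q else 0"
  define d where "d = (\<lambda>y. if bedge n (t \<circ> y) t y then ?q else 0)"
  define c where "c = (\<lambda>(K :: perm set) (y :: perm). if y (Suc i) < y i \<longleftrightarrow> transpose (y i) (y (Suc i)) \<in> K then ?q else 0)"
  have step: "walk_poly n prec J u y = ?W u y + d y * ?W u (t \<circ> y)" for u y
    unfolding J d_def by (simp add: walk_poly_insert[OF KT tT tK max])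
  have IH: "?W (u \<circ> sref i) y + ?e * ?W u y = ?W u (y \<circ> sref i) + c K y * ?W u y"
    if "y \<in> Sn n" for y
    unfolding c_def by (rule Suc.hyps(1)[OF cardK KT _ that]) (rule initK)
  have "walk_poly n prec J (u \<circ> sref i) y + ?e * walk_poly n prec J u y =
      (?W (u \<circ> sref i) y + ?e * ?W u y) + d y * (?W (u \<circ> sref i) (t \<circ> y) + ?e * ?W u (t \<circ> y))"
    by (simp add: step algebra_simps)
  also have "\<dots> = ?W u (y \<circ> sref i) + c K y * ?W u y
      + d y * (?W u (t \<circ> y \<circ> sref i) + c K (t \<circ> y) * ?W u (t \<circ> y))"
    by (simp add: IH y y')
  also have "\<dots> = ?W u (y \<circ> sref i) + d (y \<circ> sref i) * ?W u (t \<circ> (y \<circ> sref i))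
      + c J y * (?W u y + d y * ?W u (t \<circ> y))"
  proof (cases "transpose (y i) (y (Suc i)) = t")
    \<comment> \<open>Here \<open>sref i\<close> on the right moves \<open>y\<close> as
      \<open>t\<close> does on the left. Passing from \<open>K\<close> to \<open>J\<close> flips the
      coefficient \<open>c\<close> at \<open>y\<close>, and the terms with the extra last label
      \<open>t\<close> compensate for it.\<close>
    case True
    have ys: "y \<circ> sref i = t \<circ> y" using comp_sref_eq[OF y] True by simp
    then have yss: "t \<circ> y \<circ> sref i = y" "t \<circ> (y \<circ> sref i) = y"
      using Trans_involution[OF tT] by (metis sref_sref)+
    have ends: "y i = a \<and> y (Suc i) = b \<or> y i = b \<and> y (Suc i) = a"
      using True ab(3) unfolding t_eq by (metis nat_neq_iff transpose_apply_first
          transpose_apply_other transpose_apply_second transpose_eq_iff)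
    have iv: "inv y (y i) = i" "inv y (y (Suc i)) = Suc i"
      using inj by simp_all
    have dys: "d (t \<circ> y) = (if y (Suc i) < y i then 0 else ?q)"
      "d y = (if y (Suc i) < y i then ?q else 0)"
      using ends iv ab bedge_down_iff[OF y ab] bedge_down_iff[OF y'(1) ab]
      by (auto simp: d_def t_eq inv_transpose_comp[OF Sn_bij[OF y]])
    have "c K y = (if y (Suc i) < y i then 0 else ?q)" "c J y = (if y (Suc i) < y i then ?q else 0)"
      using True tK J by (auto simp: c_def)
    moreover have "c K (t \<circ> y) = (if y (Suc i) < y i then ?q else 0)"
      using ends tK ab(3) transpose_commute[of a b] by (auto simp: c_def t_eq)
    ultimately show ?thesis using dys
      by (simp add: ys yss Trans_involution[OF tT] algebra_simps)
  next
    \<comment> \<open>Here all coefficients persist: \<open>c\<close> at \<open>y\<close> is the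
      same for \<open>K\<close> and \<open>J\<close>, it is unchanged under \<open>t\<close> by
      rotation of the initial section, and \<open>sref i\<close> does not exchange the positions of
      \<open>a\<close> and \<open>b\<close>.\<close>
    case False
    have pq: "y i \<in> {1..n}" "y (Suc i) \<in> {1..n}" "y i \<noteq> y (Suc i)"
      using Sn_in[OF y, of i] Sn_in[OF y, of "Suc i"] i inj by (auto simp: inj_eq)
    have mem: "r \<in> K \<longleftrightarrow> prec r (transpose a b)" if "r \<in> Trans n" "r \<noteq> transpose a b" for r
      using that max Suc.prems(2)[OF t(1)] unfolding t_eq[symmetric] J by blast
    have "c K (t \<circ> y) = c K y"
      using initial_section_rotate[OF ab pq _ mem] False by (simp add: c_def t_eq)
    moreover have "c J y = c K y" using False by (simp add: c_def J)
    moreover have "d (y \<circ> sref i) = d y"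
    proof -
      have "sref i (inv y a) < sref i (inv y b) \<longleftrightarrow> inv y a < inv y b"
      proof -
        have "inv y a \<noteq> inv y b" using ab Sn_bij[OF y] by (metis bij_inv_eq_iff nat_neq_iff)
        moreover have "\<not> (inv y a = i \<and> inv y b = Suc i)" "\<not> (inv y b = i \<and> inv y a = Suc i)"
          using False Sn_bij[OF y] unfolding t_eq by (metis bij_inv_eq_iff transpose_commute)+
        ultimately show ?thesis by (auto simp: sref_def transpose_def)
      qed
      moreover have "sref i (inv y a) \<noteq> sref i (inv y b)" "inv y a \<noteq> inv y b"
        using ab Sn_bij[OF y]
        by (metis bij_inv_eq_iff nat_neq_iff sref_def transpose_eq_imp_eq)+
      moreover have "inv (y \<circ> sref i) x = sref i (inv y x)" for x
        using Sn_bij[OF y] by (simp add: o_inv_distrib sref_def)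
      ultimately show ?thesis
        using bedge_down_iff[OF y ab] bedge_down_iff[OF y'(2) ab] by (auto simp: d_def t_eq)
    qed
    ultimately show ?thesis by (simp add: algebra_simps o_assoc)
  qed
  also have "\<dots> = walk_poly n prec J u (y \<circ> sref i) + c J y * walk_poly n prec J u y"
    by (simp add: step)
  finally show ?case unfolding c_def .
qed

text \<open>The identity for initial sections at \<open>J = Trans n\<close> and
  \<open>y = v \<circ> sref i\<close>: this \<open>y\<close> ascends at \<open>i\<close> although
  the corresponding transposition lies in \<open>J\<close>, so the last coefficient
  vanishes.\<close>

lemma walk_poly_right_mult:
  assumes i: "1 \<le> i" "i < n" and u: "u \<in> Sn n" and v: "v \<in> Sn n" and des: "v (Suc i) < v i"
  shows "walk_poly n prec (Trans n) u v = walk_poly n prec (Trans n) (u \<circ> sref i) (v \<circ> sref i)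
    + (if u i < u (Suc i) then monom 1 1 * walk_poly n prec (Trans n) u (v \<circ> sref i) else 0)"
proof -
  let ?y = "v \<circ> sref i"
  have y: "?y \<in> Sn n" using v i by (simp add: Sn_comp sref_in_Sn)
  have "?y i < ?y (Suc i)" using des by (simp add: sref_def)
  moreover have "transpose (?y i) (?y (Suc i)) \<in> Trans n"
    using Sn_in[OF y, of i] Sn_in[OF y, of "Suc i"] i \<open>?y i < ?y (Suc i)\<close>
    by (intro transpose_in_Trans) auto
  ultimately show ?thesis
    using walk_poly_right_mult_initial[OF i u, of "Trans n" ?y] y
    by (cases "u i < u (Suc i)") simp_all
qed

end

section \<open>Dyer's formula\<close>

definition eval_int_poly :: "int poly \<Rightarrow> real \<Rightarrow> real" where
  "eval_int_poly p x = poly (map_poly of_int p) x"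

lemma eval_int_poly_0 [simp]: "eval_int_poly 0 x = 0"
  by (simp add: eval_int_poly_def)

lemma eval_int_poly_pCons [simp]: "eval_int_poly (pCons a p) x = of_int a + x * eval_int_poly p x"
  by (simp add: eval_int_poly_def map_poly_pCons)

lemma eval_int_poly_1 [simp]: "eval_int_poly 1 x = 1"
  by (simp add: one_pCons)

lemma eval_int_poly_add [simp]: "eval_int_poly (p + q) x = eval_int_poly p x + eval_int_poly q x"
proof -
  have "map_poly real_of_int (p + q) = map_poly of_int p + map_poly of_int q"
    by (rule poly_eqI) (simp add: coeff_map_poly)
  then show ?thesis by (simp add: eval_int_poly_def)
qed

lemma eval_int_poly_smult [simp]: "eval_int_poly (smult a p) x = of_int a * eval_int_poly p x"
proof -
  have "map_poly real_of_int (smult a p) = smult (of_int a) (map_poly of_int p)"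
    by (rule poly_eqI) (simp add: coeff_map_poly)
  then show ?thesis by (simp add: eval_int_poly_def)
qed

lemma eval_int_poly_mult [simp]: "eval_int_poly (p * q) x = eval_int_poly p x * eval_int_poly q x"
  by (induction p) (simp_all add: algebra_simps)

lemma eval_int_poly_eqI:
  assumes "\<And>x. eval_int_poly p x = eval_int_poly q x" shows "p = q"
proof -
  have "map_poly real_of_int p = map_poly of_int q"
    using assms by (simp add: eval_int_poly_def poly_eq_poly_eq_iff[symmetric] fun_eq_iff)
  then have "coeff (map_poly real_of_int p) k = coeff (map_poly of_int q) k" for k by simp
  then show ?thesis by (intro poly_eqI) (simp add: coeff_map_poly)
qed

text \<open>Makes the polynomial in the definition of \<open>Rtilde\<close> unique: its values are
  prescribed at every real number.\<close>

lemma sqrt_minus_inverse_surj: "\<exists>q>0. sqrt q - 1 / sqrt q = x"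
proof -
  \<comment> \<open>The positive root of r^2 - x r - 1 = 0; its square is the witness for
    \<open>q\<close>.\<close>
  define r where "r = (x + sqrt (x\<^sup>2 + 4)) / 2"
  have "\<bar>x\<bar> < sqrt (x\<^sup>2 + 4)" by (rule real_less_rsqrt) simp
  then have "r > 0" by (simp add: r_def)
  have "(sqrt (x\<^sup>2 + 4))\<^sup>2 = x\<^sup>2 + 4" by simp
  then have "r * r - 1 = x * r" by (simp add: r_def field_simps power2_eq_square)
  then have "r - 1 / r = x" using \<open>r > 0\<close> by (simp add: field_simps)
  then show ?thesis using \<open>r > 0\<close> by (intro exI[of _ "r\<^sup>2"]) simp
qed

context refl_order
begin

text \<open>Both sides obey the same recursion at the smallest right descent of \<open>v\<close>.
  The fuel equals \<open>len n v\<close> and drops together with it; at fuel 0 the relation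
  \<open>bruhat_le n u v\<close> forces \<open>u = v\<close>.\<close>

lemma eval_Rfuel:
  assumes q: "q > 0"
  shows "u \<in> Sn n \<Longrightarrow> v \<in> Sn n \<Longrightarrow> len n v = k \<Longrightarrow>
    eval_int_poly (Rfuel n k u v) q = q powr ((real (len n v) - real (len n u)) / 2)
      * eval_int_poly (walk_poly n prec (Trans n) u v) (sqrt q - 1 / sqrt q)"
proof (induction k arbitrary: u v)
  case 0
  show ?case
  proof (cases "bruhat_le n u v")
    case True
    then have "u = v" using bruhat_le_len 0(3) by fastforce
    then show ?thesis using 0 q True by (simp add: walk_poly_same)
  next
    case False
    then show ?thesis using 0 by (simp add: walk_poly_not_le)
  qed
next
  case (Suc k)
  note u = \<open>u \<in> Sn n\<close> and v = \<open>v \<in> Sn n\<close>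
  consider "\<not> bruhat_le n u v" | "bruhat_le n u v" "u = v" | "bruhat_le n u v" "u \<noteq> v" by blast
  then show ?case
  proof cases
    case 1
    then show ?thesis using u by (simp add: walk_poly_not_le)
  next
    case 2
    then show ?thesis using q by (simp add: walk_poly_same)
  next
    case 3
    let ?W = "walk_poly n prec (Trans n)" and ?x = "sqrt q - 1 / sqrt q"
    define i where "i = Min (Des n v)"
    have "Des n v \<noteq> {}" using Des_nonempty[OF v] Suc.prems(3) by simp
    then have iv: "i \<in> Des n v" unfolding i_def by (intro Min_in finite_Des)
    then have i: "1 \<le> i" "i < n" by (auto simp: Des_def)
    have des: "v (Suc i) < v i" using iv Des_iff[OF v i] by simp
    have us: "u \<circ> sref i \<in> Sn n" and vs: "v \<circ> sref i \<in> Sn n"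
      using u v i by (simp_all add: Sn_comp sref_in_Sn)
    have lvs: "len n (v \<circ> sref i) = k"
      using len_swap_adjacent[OF i, of "v \<circ> sref i"] des Suc.prems(3) by simp
    note IH = Suc.IH[OF _ vs lvs]
    show ?thesis
    proof (cases "i \<in> Des n u")
      case True
      then have desu: "u (Suc i) < u i" using Des_iff[OF u i] by simp
      then have lus: "len n u = Suc (len n (u \<circ> sref i))"
        using len_swap_adjacent[OF i, of "u \<circ> sref i"] by simp
      have Req: "Rfuel n (Suc k) u v = Rfuel n k (u \<circ> sref i) (v \<circ> sref i)"
        using 3 True by (simp add: i_def Let_def)
      have Weq: "?W u v = ?W (u \<circ> sref i) (v \<circ> sref i)"
        using walk_poly_right_mult[OF i u v des] desu by simp
      have "real (len n v) - real (len n u) = real (len n (v \<circ> sref i)) - real (len n (u \<circ> sref i))"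
        using lvs lus Suc.prems(3) by simp
      then show ?thesis unfolding Req Weq using IH[OF us] by (simp only:)
    next
      case False
      have "u i \<noteq> u (Suc i)" using Sn_bij[OF u] by (simp add: bij_def inj_eq)
      then have asc: "u i < u (Suc i)" using Des_iff[OF u i] False by simp
      then have lus: "len n (u \<circ> sref i) = Suc (len n u)"
        by (rule len_swap_adjacent[OF i])
      \<comment> \<open>\<open>e\<close> is half the length difference of \<open>u\<close> and
        \<open>v \<circ> sref i\<close>. Lengthening \<open>u\<close> lowers the exponent to
        \<open>e - 1/2\<close>, and the target exponent is \<open>e + 1/2\<close>; the factor
        \<open>q\<close> makes up for the former, and \<open>q - 1\<close> equals
        \<open>sqrt q\<close> times the argument \<open>?x\<close>.\<close>
      define e where "e = (real k - real (len n u)) / 2"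
      define A where "A = eval_int_poly (?W (u \<circ> sref i) (v \<circ> sref i)) ?x"
      define B where "B = eval_int_poly (?W u (v \<circ> sref i)) ?x"
      have Req: "Rfuel n (Suc k) u v = [:0, 1:] * Rfuel n k (u \<circ> sref i) (v \<circ> sref i)
          + [:-1, 1:] * Rfuel n k u (v \<circ> sref i)"
        using 3 False unfolding i_def by (simp only: Rfuel.simps Let_def if_False not_True_eq_False)
      have "eval_int_poly (Rfuel n (Suc k) u v) q =
          q * eval_int_poly (Rfuel n k (u \<circ> sref i) (v \<circ> sref i)) q
          + (q - 1) * eval_int_poly (Rfuel n k u (v \<circ> sref i)) q"
        unfolding Req eval_int_poly_add eval_int_poly_mult eval_int_poly_pCons by simp
      also have "\<dots> = q * q powr (e - 1/2) * A + (q - 1) * q powr e * B"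
      proof -
        have "(real k - real (Suc (len n u))) / 2 = e - 1/2" by (simp add: e_def field_simps)
        then show ?thesis
          unfolding IH[OF us] IH[OF u] lvs lus A_def B_def e_def[symmetric] by (simp only: mult.assoc)
      qed
      also have "q * q powr (e - 1/2) = q powr (e + 1/2)"
        using q powr_add[of q 1 "e - 1/2"] by (simp add: add.commute)
      also have "(q - 1) * q powr e = q powr (e + 1/2) * ?x"
        using q by (simp add: powr_add powr_half_sqrt algebra_simps)
      also have "q powr (e + 1/2) * A + q powr (e + 1/2) * ?x * B = q powr (e + 1/2) * (A + ?x * B)"
        by (simp add: algebra_simps)
      also have "A + ?x * B = eval_int_poly (?W u v) ?x"
        using walk_poly_right_mult[OF i u v des] asc by (simp add: A_def B_def monom_Suc)
      also have "e + 1/2 = (real (len n v) - real (len n u)) / 2"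
        using Suc.prems(3) by (simp add: e_def field_simps)
      finally show ?thesis .
    qed
  qed
qed

text \<open>Dyer's formula. The path polynomial satisfies the defining equation, and a second
  solution would agree with it at every real point. In particular the right-hand side is the same
  for all reflection orders.\<close>

theorem Rtilde_eq_walk_poly:
  assumes u: "u \<in> Sn n" and v: "v \<in> Sn n"
  shows "Rtilde n u v = walk_poly n prec (Trans n) u v"
proof -
  let ?P = "\<lambda>p. \<forall>q::real. q > 0 \<longrightarrow> eval_int_poly (Rpoly n u v) q =
    q powr ((real (len n v) - real (len n u)) / 2) * eval_int_poly p (sqrt q - 1 / sqrt q)"
  have W: "?P (walk_poly n prec (Trans n) u v)"
    using eval_Rfuel[OF _ u v refl] by (simp add: Rpoly_def)
  have "p = p'" if p: "?P p" and p': "?P p'" for p p'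
  proof (rule eval_int_poly_eqI)
    fix x
    obtain q where q: "q > 0" "sqrt q - 1 / sqrt q = x" using sqrt_minus_inverse_surj by blast
    have "q powr ((real (len n v) - real (len n u)) / 2) \<noteq> 0" using q by simp
    then show "eval_int_poly p x = eval_int_poly p' x"
      using p[rule_format, OF q(1)] p'[rule_format, OF q(1)] q(2) by simp
  qed
  then have "(THE p. ?P p) = walk_poly n prec (Trans n) u v" using W by (intro the_equality) blast+
  then show ?thesis unfolding Rtilde_def eval_int_poly_def .
qed

end

section \<open>Diamonds\<close>

lemma bedge_comp_cancel:
  assumes x: "x \<in> Sn n" and "f \<circ> (g \<circ> x) = f' \<circ> (g' \<circ> x)"
  shows "f \<circ> g = f' \<circ> g'"
proof
  fix z
  obtain k where "z = x k" using Sn_bij[OF x] by (metis bij_pointE)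
  then show "(f \<circ> g) z = (f' \<circ> g') z" using fun_cong[OF assms(2), of k] by simp
qed

text \<open>If the product returns \<open>e\<close> to its place, the second transposition sends
  \<open>f\<close> back to \<open>e\<close> and so equals the first. Hence in a product other than
  the identity both endpoints of the first factor are moved, which leaves finitely many candidates
  for it.\<close>

lemma transpose_moved:
  assumes "e \<noteq> f" "g \<noteq> h" "transpose g h \<circ> transpose e f = s" "s e = e"
  shows "s = id"
proof -
  have "transpose g h f = e" using assms(3,4) by auto
  then have "transpose g h = transpose e f"
    using assms(1) by (auto simp: transpose_def fun_eq_iff split: if_splits)
  then show ?thesis using assms(3) by auto
qed

text \<open>These solve for the second factor in the other two factorizations of the 3-cycle
  \<open>transpose a c \<circ> transpose a b\<close>.\<close>

lemma rotate_three_cycle: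
  assumes "a \<noteq> b" "b \<noteq> c" "c \<noteq> a"
  shows "transpose a c \<circ> transpose a b \<circ> transpose b c = transpose a b"
    and "transpose a c \<circ> transpose a b \<circ> transpose a c = transpose b c"
  using assms by (auto simp: fun_eq_iff transpose_def)

text \<open>The two alternatives are the remaining factorizations of a 3-cycle; their ascent
  conditions are rewritten in terms of positions in \<open>x\<close>, so that they can be compared
  with those of the given path.\<close>

lemma two_step_overlapping:
  assumes abc: "a \<in> {1..n}" "b \<in> {1..n}" "c \<in> {1..n}" "a \<noteq> b" "b \<noteq> c" "c \<noteq> a"
    and e1: "bedge n x d1 y" and e2: "bedge n y d2 w"
    and w: "w = transpose a c \<circ> (transpose a b \<circ> x)" and ne: "d1 \<noteq> transpose a b"
  shows "d1 = transpose b c \<and> d2 = transpose a b \<and>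
      (b < c \<longleftrightarrow> inv x b < inv x c) \<and> (a < b \<longleftrightarrow> inv x a < inv x c) \<or>
    d1 = transpose a c \<and> d2 = transpose b c \<and>
      (a < c \<longleftrightarrow> inv x a < inv x c) \<and> (b < c \<longleftrightarrow> inv x b < inv x a)"
proof -
  have x: "x \<in> Sn n" and y: "y \<in> Sn n" using e1 bedge_Sn by blast+
  have P: "inv x a \<noteq> inv x b" "inv x b \<noteq> inv x c" "inv x a \<noteq> inv x c"
    using abc Sn_bij[OF x] by (metis bij_inv_eq_iff)+
  obtain e f where ef: "e \<noteq> f" "d1 = transpose e f" and y_eq: "y = d1 \<circ> x" using e1 by (rule bedgeE)
  obtain g h where gh: "g \<noteq> h" "d2 = transpose g h" and w_eq: "w = d2 \<circ> y" using e2 by (rule bedgeE)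
  let ?s = "transpose a c \<circ> transpose a b"
  have s: "d2 \<circ> d1 = ?s" using bedge_comp_cancel[OF x] w w_eq y_eq by metis
  have "?s \<noteq> id" using abc by (auto simp: fun_eq_iff transpose_def)
  moreover have "?s z = z" if "z \<notin> {a, b, c}" for z using that by (auto simp: transpose_def)
  ultimately have "e \<in> {a, b, c}" "f \<in> {a, b, c}"
    using transpose_moved[of e f g h ?s] transpose_moved[of f e g h ?s] s ef gh
    by (auto simp: transpose_commute[of f e])
  then consider "d1 = transpose b c" | "d1 = transpose a c"
    using ef ne by (auto simp: transpose_commute)
  then show ?thesis
  proof cases
    case 1
    have d2: "d2 = transpose a b"
      using s rotate_three_cycle(1)[OF abc(4-6)] unfolding 1
      by (metis comp_assoc comp_id transpose_comp_involutory)
    have "b < c \<longleftrightarrow> inv x b < inv x c" using e1 bedge_transpose_iff[OF x abc(2,3,5)] 1 by simp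
    moreover have "a < b \<longleftrightarrow> inv y a < inv y b" using e2 bedge_transpose_iff[OF y abc(1,2,4)] d2 by simp
    moreover have "inv y a = inv x a" "inv y b = inv x c"
      using abc by (simp_all add: y_eq 1 inv_transpose_comp[OF Sn_bij[OF x]])
    ultimately show ?thesis using 1 d2 by simp
  next
    case 2
    have d2: "d2 = transpose b c"
      using s rotate_three_cycle(2)[OF abc(4-6)] unfolding 2
      by (metis comp_assoc comp_id transpose_comp_involutory)
    have "a < c \<longleftrightarrow> inv x a < inv x c" using e1 bedge_transpose_iff[OF x abc(1,3)] abc 2 by simp
    moreover have "b < c \<longleftrightarrow> inv y b < inv y c" using e2 bedge_transpose_iff[OF y abc(2,3,5)] d2 by simp
    moreover have "inv y b = inv x b" "inv y c = inv x a"
      using abc by (simp_all add: y_eq 2 inv_transpose_comp[OF Sn_bij[OF x]])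
    ultimately show ?thesis using 2 d2 by simp
  qed
qed

lemma two_step_disjoint:
  assumes abcd: "distinct [a, b, c, d]"
    and e1: "bedge n x d1 y" and e2: "bedge n y d2 w"
    and w: "w = transpose c d \<circ> (transpose a b \<circ> x)" and ne: "d1 \<noteq> transpose a b"
  shows "d1 = transpose c d \<and> d2 = transpose a b"
proof -
  have x: "x \<in> Sn n" using e1 bedge_Sn by blast
  obtain e f where ef: "e \<noteq> f" "d1 = transpose e f" and y_eq: "y = d1 \<circ> x" using e1 by (rule bedgeE)
  obtain g h where gh: "g \<noteq> h" "d2 = transpose g h" and w_eq: "w = d2 \<circ> y" using e2 by (rule bedgeE)
  let ?s = "transpose c d \<circ> transpose a b"
  have s: "d2 \<circ> d1 = ?s" using bedge_comp_cancel[OF x] w w_eq y_eq by metis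
  have "?s a \<noteq> a" using abcd by simp
  then have "?s \<noteq> id" by (metis id_apply)
  moreover have "?s z = z" if "z \<notin> {a, b, c, d}" for z using that by (auto simp: transpose_def)
  ultimately have "e \<in> {a, b, c, d}" "f \<in> {a, b, c, d}"
    using transpose_moved[of e f g h ?s] transpose_moved[of f e g h ?s] s ef gh
    by (auto simp: transpose_commute[of f e])
  then consider "d1 = transpose c d" | "d1 = transpose a c" | "d1 = transpose a d"
    | "d1 = transpose b c" | "d1 = transpose b d"
    using ef ne by (auto simp: transpose_commute)
  moreover have d2: "d2 = ?s \<circ> d1" using s ef(2)
    by (metis comp_assoc comp_id transpose_comp_involutory)
  \<comment> \<open>A first factor mixing the two pairs, such as \<open>transpose a c\<close>, would
    make \<open>d2\<close> a 4-cycle; that \<open>d2\<close> is an involution excludes these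
    cases.\<close>
  have inv: "d2 (d2 z) = z" for z using gh by simp
  ultimately show ?thesis
  proof cases
    case 1
    then show ?thesis using d2 abcd by (auto simp: fun_eq_iff transpose_def)
  qed (use abcd inv[of a] inv[of b] in \<open>auto simp: d2 transpose_def\<close>)
qed

text \<open>All ascent conditions refer to positions in \<open>x\<close>. In the overlapping case
  \<open>a\<close> is the shared value; after the first step it occupies the former place of
  \<open>b\<close>, which is why the second condition compares the positions of \<open>b\<close> and
  \<open>c\<close>.\<close>

lemma two_step_cases:
  assumes e1: "bedge n x t1 y" and e2: "bedge n y t2 w"
  obtains (disjoint) a b c d where "a \<in> {1..n}" "b \<in> {1..n}" "c \<in> {1..n}" "d \<in> {1..n}"
      "distinct [a, b, c, d]" "t1 = transpose a b" "t2 = transpose c d"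
      "a < b \<longleftrightarrow> inv x a < inv x b" "c < d \<longleftrightarrow> inv x c < inv x d"
    | (overlapping) a b c where "a \<in> {1..n}" "b \<in> {1..n}" "c \<in> {1..n}"
      "a \<noteq> b" "b \<noteq> c" "c \<noteq> a" "t1 = transpose a b" "t2 = transpose a c"
      "a < b \<longleftrightarrow> inv x a < inv x b" "a < c \<longleftrightarrow> inv x b < inv x c"
proof -
  have x: "x \<in> Sn n" and y: "y \<in> Sn n" using e1 bedge_Sn by blast+
  obtain a b where ab: "a \<in> {1..n}" "b \<in> {1..n}" "a \<noteq> b" "t1 = transpose a b"
      "a < b \<longleftrightarrow> inv x a < inv x b" and y_eq: "y = t1 \<circ> x"
    using e1 by (rule bedgeE)
  obtain c d where cd: "c \<in> {1..n}" "d \<in> {1..n}" "c \<noteq> d" "t2 = transpose c d"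
      "c < d \<longleftrightarrow> inv y c < inv y d" and w_eq: "w = t2 \<circ> y"
    using e2 by (rule bedgeE)
  have iy: "inv y z = inv x (transpose a b z)" for z
    by (simp add: y_eq ab(4) inv_transpose_comp[OF Sn_bij[OF x]])
  have "t1 \<noteq> t2"
  proof
    assume "t1 = t2"
    then have "w = x" using w_eq y_eq Trans_involution[OF transpose_in_Trans[OF ab(1-3)]] ab(4) by simp
    then show False using e1 e2 by (auto simp: bedge_def)
  qed
  have inj: "inv x p = inv x q \<longleftrightarrow> p = q" for p q using Sn_bij[OF x] by (metis bij_inv_eq_iff)
  have share: thesis if "p \<in> {1..n}" "q \<in> {1..n}" "r \<in> {1..n}" "p \<noteq> q" "p \<noteq> r"
      "t1 = transpose p q" "t2 = transpose p r" "{p, q} = {a, b}" "{p, r} = {c, d}" for p q r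
  proof (rule overlapping[of p q r])
    show "q \<noteq> r" using \<open>t1 \<noteq> t2\<close> that by auto
    have "inv x p \<noteq> inv x q" using inj that by simp
    then show "p < q \<longleftrightarrow> inv x p < inv x q" using ab(3,5) that(8) by (auto simp: doubleton_eq_iff)
    have "inv y p = inv x q" "inv y r = inv x r"
      using that \<open>q \<noteq> r\<close> iy ab(4) by (metis transpose_apply_first transpose_apply_other)+
    moreover have "inv x q \<noteq> inv x r" using inj \<open>q \<noteq> r\<close> by simp
    ultimately show "p < r \<longleftrightarrow> inv x q < inv x r"
      using cd(3,5) that(5,9) by (auto simp: doubleton_eq_iff)
  qed (use that in auto)
  consider "distinct [a, b, c, d]" | "a = c" | "a = d" | "b = c" | "b = d"
    using ab(3) cd(3) by auto
  then show thesis
  proof cases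
    case 1
    then show ?thesis using disjoint[of a b c d] ab cd iy by simp
  next
    case 2
    then show ?thesis using share[of a b d] ab cd by auto
  next
    case 3
    then show ?thesis using share[of a b c] ab cd by (auto simp: transpose_commute)
  next
    case 4
    then show ?thesis using share[of b a d] ab cd by (auto simp: transpose_commute)
  next
    case 5
    then show ?thesis using share[of b a c] ab cd by (auto simp: transpose_commute)
  qed
qed

text \<open>Disjoint labels may be exchanged. For overlapping labels, comparing the orders of
  \<open>a\<close>, \<open>b\<close>, \<open>c\<close> and of their positions shows that at least
  one of the other two factorizations of the 3-cycle ascends.\<close>

lemma diamond_exists:
  assumes e1: "bedge n x t1 y" and e2: "bedge n y t2 w"
  obtains d1 y' d2 where "y' \<noteq> y" "bedge n x d1 y'" "bedge n y' d2 w"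
proof -
  have x: "x \<in> Sn n" using e1 bedge_Sn by blast
  have w: "w = t2 \<circ> (t1 \<circ> x)" and y: "y = t1 \<circ> x" using e1 e2 by (auto simp: bedge_def)
  have Px: "inv (transpose p q \<circ> x) r = inv x (transpose p q r)" for p q r
    by (rule inv_transpose_comp[OF Sn_bij[OF x]])
  have Sn: "transpose p q \<circ> x \<in> Sn n" if "p \<in> {1..n}" "q \<in> {1..n}" for p q
    by (intro Sn_comp transpose_in_Sn that x)
  have neq: "transpose p q \<circ> x \<noteq> y" if "transpose p q \<noteq> t1" for p q
  proof
    assume eq: "transpose p q \<circ> x = y"
    have "transpose p q z = t1 z" for z
    proof -
      obtain k where "z = x k" using Sn_bij[OF x] by (metis bij_pointE)
      then show ?thesis using fun_cong[OF eq, of k] by (simp add: y)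
    qed
    then show False using that by blast
  qed
  from e1 e2 show thesis
  proof (cases rule: two_step_cases)
    case (disjoint a b c d)
    show ?thesis
    proof (rule that)
      show "transpose c d \<circ> x \<noteq> y"
        using disjoint by (intro neq) (auto simp: fun_eq_iff transpose_def)
      show "bedge n x (transpose c d) (transpose c d \<circ> x)"
        using disjoint by (simp add: bedge_transpose_iff[OF x])
      show "bedge n (transpose c d \<circ> x) (transpose a b) w"
        using disjoint w by (simp add: bedge_transpose_iff[OF Sn] Px fun_eq_iff) (simp add: transpose_def)
    qed
  next
    case (overlapping a b c)
    have inj: "inv x p = inv x q \<longleftrightarrow> p = q" for p q using Sn_bij[OF x] by (metis bij_inv_eq_iff)
    have ne: "inv x a \<noteq> inv x b" "inv x b \<noteq> inv x c" "inv x a \<noteq> inv x c"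
      using overlapping by (simp_all add: inj)
    have w1: "w = transpose a b \<circ> (transpose b c \<circ> x)" and w2: "w = transpose b c \<circ> (transpose a c \<circ> x)"
      using overlapping(4-8) unfolding w by (auto simp: fun_eq_iff transpose_def)
    have "(b < c \<longleftrightarrow> inv x b < inv x c) \<and> (a < b \<longleftrightarrow> inv x a < inv x c) \<or>
        (a < c \<longleftrightarrow> inv x a < inv x c) \<and> (b < c \<longleftrightarrow> inv x b < inv x a)"
      using overlapping(4-6,9,10) ne by linarith
    then show ?thesis
    proof
      assume "(b < c \<longleftrightarrow> inv x b < inv x c) \<and> (a < b \<longleftrightarrow> inv x a < inv x c)"
      then have "bedge n x (transpose b c) (transpose b c \<circ> x)"
        and "bedge n (transpose b c \<circ> x) (transpose a b) w"
        using overlapping(1-6) w1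
        by (simp_all add: bedge_transpose_iff[OF x] bedge_transpose_iff[OF Sn] Px)
      moreover have "transpose b c a \<noteq> t1 a" using overlapping(4-7) by simp
      ultimately show ?thesis using that neq by metis
    next
      assume "(a < c \<longleftrightarrow> inv x a < inv x c) \<and> (b < c \<longleftrightarrow> inv x b < inv x a)"
      then have "bedge n x (transpose a c) (transpose a c \<circ> x)"
        and "bedge n (transpose a c \<circ> x) (transpose b c) w"
        using overlapping(1-6) w2
        by (simp_all add: bedge_transpose_iff[OF x] bedge_transpose_iff[OF Sn] Px)
      moreover have "transpose a c a \<noteq> t1 a" using overlapping(4-7) by simp
      ultimately show ?thesis using that neq by metis
    qed
  qed
qed

text \<open>Complements the existence of a second side: the ascent conditions of the two remaining
  factorizations of a 3-cycle are never satisfied together.\<close>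

lemma diamond_unique:
  assumes "bedge n x t1 y" "bedge n y t2 w"
    and "bedge n x d1 y'" "bedge n y' d2 w" "y' \<noteq> y"
    and "bedge n x r1 y''" "bedge n y'' r2 w" "y'' \<noteq> y"
  shows "y' = y''"
proof -
  have x: "x \<in> Sn n" using assms(1) bedge_Sn by blast
  have w: "w = t2 \<circ> (t1 \<circ> x)" and y: "y = t1 \<circ> x" "y' = d1 \<circ> x" "y'' = r1 \<circ> x"
    using assms by (auto simp: bedge_def)
  then have ne: "d1 \<noteq> t1" "r1 \<noteq> t1" using assms by auto
  have "d1 = r1"
    using assms(1,2)
  proof (cases rule: two_step_cases)
    case (disjoint a b c d)
    then show ?thesis
      using two_step_disjoint[OF disjoint(5) assms(3,4)] two_step_disjoint[OF disjoint(5) assms(6,7)]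
        ne w by simp
  next
    case (overlapping a b c)
    note * = two_step_overlapping[OF overlapping(1-6)]
    have inj: "inv x p = inv x q \<longleftrightarrow> p = q" for p q using Sn_bij[OF x] by (metis bij_inv_eq_iff)
    have P: "inv x a \<noteq> inv x b" "inv x b \<noteq> inv x c" "inv x a \<noteq> inv x c"
      using overlapping by (simp_all add: inj)
    have "\<not> ((b < c \<longleftrightarrow> inv x b < inv x c) \<and> (a < b \<longleftrightarrow> inv x a < inv x c) \<and>
        (a < c \<longleftrightarrow> inv x a < inv x c) \<and> (b < c \<longleftrightarrow> inv x b < inv x a))"
      using overlapping(4-6,9,10) P by linarith
    then show ?thesis using *[OF assms(3,4)] *[OF assms(6,7)] w overlapping(7,8) ne by blast
  qed
  then show ?thesis using y by simp
qed

context refl_order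
begin

text \<open>For disjoint labels the two sides carry the same labels in opposite order. For
  overlapping ones the sides share a label, which makes one equivalence trivial; the other fails
  only if that shared label is the middle one of the three reflections, that is, swaps the extreme
  values. The ascents rule this out.\<close>

lemma diamond_order:
  assumes e: "bedge n x t1 y" "bedge n y t2 w"
    and d: "bedge n x d1 y'" "bedge n y' d2 w" and neq: "y' \<noteq> y"
  shows "prec t1 t2 \<longleftrightarrow> prec t1 d1" and "prec t1 t2 \<longleftrightarrow> prec d2 t2"
proof -
  have x: "x \<in> Sn n" using e bedge_Sn by blast
  have w: "w = t2 \<circ> (t1 \<circ> x)" and y: "y = t1 \<circ> x" "y' = d1 \<circ> x"
    using assms by (auto simp: bedge_def)
  then have ne: "d1 \<noteq> t1" using assms by auto
  have "(prec t1 t2 \<longleftrightarrow> prec t1 d1) \<and> (prec t1 t2 \<longleftrightarrow> prec d2 t2)"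
    using e
  proof (cases rule: two_step_cases)
    case (disjoint a b c d')
    then have "d1 = t2 \<and> d2 = t1" using two_step_disjoint[OF disjoint(5) d] ne w by simp
    then show ?thesis by simp
  next
    case (overlapping a b c)
    note * = two_step_overlapping[OF overlapping(1-6) d]
    have inj: "inv x p = inv x q \<longleftrightarrow> p = q" for p q using Sn_bij[OF x] by (metis bij_inv_eq_iff)
    have P: "inv x a \<noteq> inv x b" "inv x b \<noteq> inv x c" "inv x a \<noteq> inv x c"
      using overlapping by (simp_all add: inj)
    have T: "transpose a b \<in> Trans n" "transpose b c \<in> Trans n" "transpose a c \<in> Trans n"
      using overlapping by (auto intro!: transpose_in_Trans)
    have swap: "transpose b a = transpose a b" "transpose c b = transpose b c"
      "transpose c a = transpose a c" by (simp_all add: transpose_commute)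
    have mid_b: "prec (transpose a b) (transpose a c) \<and> prec (transpose a c) (transpose b c) \<or>
        prec (transpose b c) (transpose a c) \<and> prec (transpose a c) (transpose a b)"
      if "a < b \<and> b < c \<or> c < b \<and> b < a"
      using that betweenness[of a b c] betweenness[of c b a] overlapping unfolding swap by auto
    have mid_a: "prec (transpose a b) (transpose b c) \<and> prec (transpose b c) (transpose a c) \<or>
        prec (transpose a c) (transpose b c) \<and> prec (transpose b c) (transpose a b)"
      if "b < a \<and> a < c \<or> c < a \<and> a < b"
      using that betweenness[of b a c] betweenness[of c a b] overlapping unfolding swap by auto
    have mid_c: "prec (transpose a c) (transpose a b) \<and> prec (transpose a b) (transpose b c) \<or>
        prec (transpose b c) (transpose a b) \<and> prec (transpose a b) (transpose a c)"
      if "a < c \<and> c < b \<or> b < c \<and> c < a"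
      using that betweenness[of a c b] betweenness[of b c a] overlapping unfolding swap by auto
    note order = prec_asym[OF _ T(1) T(2)] prec_asym[OF _ T(1) T(3)] prec_asym[OF _ T(2) T(3)]
      prec_asym[OF _ T(2) T(1)] prec_asym[OF _ T(3) T(1)] prec_asym[OF _ T(3) T(2)]
      prec_trans[OF _ _ T(1) T(2) T(3)] prec_trans[OF _ _ T(3) T(2) T(1)]
      prec_trans[OF _ _ T(2) T(3) T(1)] prec_trans[OF _ _ T(1) T(3) T(2)]
      prec_trans[OF _ _ T(3) T(1) T(2)] prec_trans[OF _ _ T(2) T(1) T(3)]
    from *[unfolded overlapping(7,8)[symmetric], OF w ne] show ?thesis
    proof (elim disjE conjE)
      assume d12: "d1 = transpose b c" "d2 = t1"
        and v: "b < c \<longleftrightarrow> inv x b < inv x c" "a < b \<longleftrightarrow> inv x a < inv x c"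
      \<comment> \<open>The shared label is \<open>transpose a b\<close>; it would be the middle
        reflection exactly if \<open>c\<close> were between \<open>a\<close> and
        \<open>b\<close>.\<close>
      have "\<not> (a < c \<and> c < b \<or> b < c \<and> c < a)"
        using v overlapping(4-6,9,10) P by linarith
      then have "a < b \<and> b < c \<or> c < b \<and> b < a \<or> b < a \<and> a < c \<or> c < a \<and> a < b"
        using overlapping(4-6) by linarith
      then show ?thesis using mid_b mid_a order unfolding d12 overlapping(7,8) by blast
    next
      assume d12: "d1 = t2" "d2 = transpose b c"
        and v: "a < c \<longleftrightarrow> inv x a < inv x c" "b < c \<longleftrightarrow> inv x b < inv x a"
      \<comment> \<open>The shared label is now \<open>transpose a c\<close>, so \<open>b\<close>
        must not lie between \<open>a\<close> and \<open>c\<close>.\<close>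
      have "\<not> (a < b \<and> b < c \<or> c < b \<and> b < a)"
        using v overlapping(4-6,9,10) P by linarith
      then have "b < a \<and> a < c \<or> c < a \<and> a < b \<or> a < c \<and> c < b \<or> b < c \<and> c < a"
        using overlapping(4-6) by linarith
      then show ?thesis using mid_a mid_c order unfolding d12 overlapping(7,8) by blast
    qed
  qed
  then show "prec t1 t2 \<longleftrightarrow> prec t1 d1" and "prec t1 t2 \<longleftrightarrow> prec d2 t2" by blast+
qed

end

section \<open>Increasing paths in a hypercube cluster\<close>

text \<open>
  \<open>cube_walk n A \<theta> Z ts\<close>: the labels \<open>ts\<close> are read off along the image under \<open>\<theta>\<close> of a maximal
  chain of subsets of \<open>Z\<close>.
\<close>

inductive cube_walk ::
  "nat \<Rightarrow> perm set set \<Rightarrow> (perm set \<Rightarrow> perm) \<Rightarrow> perm set \<Rightarrow> perm list \<Rightarrow> bool"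
  for n A th where
  cube_walk_empty: "cube_walk n A th {} []"
| cube_walk_insert: "cube_walk n A th Z ts \<Longrightarrow> z \<notin> Z \<Longrightarrow> insert z Z \<in> A \<Longrightarrow>
    bedge n (th Z) t (th (insert z Z)) \<Longrightarrow> cube_walk n A th (insert z Z) (ts @ [t])"

locale hc_cluster = refl_order +
  fixes u v :: perm and I :: "perm set" and x :: perm and th :: "perm set \<Rightarrow> perm"
  assumes ideal: "order_ideal n u v I" and x_in: "x \<in> I"
    and cluster: "strong_hc_cluster n u v I x th"
begin

abbreviation A :: "perm set set" where "A \<equiv> Aset n u v I x"

lemma A_subset: "Y \<in> A \<Longrightarrow> Z \<subseteq> Y \<Longrightarrow> Z \<in> A"
  by (auto simp: Aset_def antichain_def)

lemma A_finite:
  assumes "Y \<in> A" shows "finite Y"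
proof -
  have "Y \<subseteq> Sn n"
    using assms by (auto simp: Aset_def Yset_def interval_def dest: bruhat_le_Sn)
  then show ?thesis by (rule finite_subset[OF _ finite_Sn])
qed

lemma empty_in_A: "{} \<in> A"
  by (simp add: Aset_def antichain_def)

lemma th_interval: "Y \<in> A \<Longrightarrow> th Y \<in> interval n u v"
  using cluster by (simp add: strong_hc_cluster_def)

lemma th_empty: "th {} = x"
  using cluster by (simp add: strong_hc_cluster_def)

lemma th_singleton: "{y} \<in> A \<Longrightarrow> th {y} = y"
  using cluster by (simp add: strong_hc_cluster_def Aset_def)

lemma th_insert_edge:
  assumes "insert z Z \<in> A" "z \<notin> Z"
  obtains t where "bedge n (th Z) t (th (insert z Z))"
proof -
  have "Z \<in> A" using A_subset[OF assms(1)] by blast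
  moreover have "Z \<subset> insert z Z" "card (insert z Z - Z) = 1"
    using assms(2) by (auto simp: insert_Diff_if)
  ultimately have "bedge' n (th Z) (th (insert z Z))"
    using cluster assms(1) unfolding strong_hc_cluster_def by blast
  then show ?thesis using that by (auto simp: bedge'_def)
qed

text \<open>If \<open>insert a (insert c Z)\<close> and \<open>insert b (insert c Z)\<close> had the
  same image \<open>w\<close>, then \<open>th (insert a Z)\<close> and
  \<open>th (insert b Z)\<close> would both be the second side of the diamond through
  \<open>th Z\<close>, \<open>th (insert c Z)\<close> and \<open>w\<close>, hence equal, and the
  claim for \<open>Z\<close> applies.\<close>

lemma th_insert_inj:
  assumes "finite Z"
  shows "insert a Z \<in> A \<Longrightarrow> insert b Z \<in> A \<Longrightarrow> a \<notin> Z \<Longrightarrow> b \<notin> Z \<Longrightarrow>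
    th (insert a Z) = th (insert b Z) \<Longrightarrow> a = b"
  using assms
proof (induction Z arbitrary: a b rule: finite_induct)
  case empty
  then show ?case by (simp add: th_singleton)
next
  case (insert c Z)
  show ?case
  proof (rule ccontr)
    assume "a \<noteq> b"
    let ?w = "th (insert a (insert c Z))"
    have A: "insert a Z \<in> A" "insert b Z \<in> A" "insert c Z \<in> A"
      using A_subset[OF insert.prems(1)] A_subset[OF insert.prems(2)] by blast+
    have swap: "insert a (insert c Z) = insert c (insert a Z)"
      "insert b (insert c Z) = insert c (insert b Z)" by blast+
    have notin: "a \<notin> Z" "b \<notin> Z" "a \<noteq> c" "b \<noteq> c" "c \<notin> insert a Z" "c \<notin> insert b Z"
      using insert by auto
    obtain t1 where t1: "bedge n (th Z) t1 (th (insert c Z))"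
      using th_insert_edge[OF A(3)] insert.hyps by blast
    obtain t2 where t2: "bedge n (th (insert c Z)) t2 ?w"
      using th_insert_edge[OF insert.prems(1)] notin insert.prems by blast
    obtain a1 where a1: "bedge n (th Z) a1 (th (insert a Z))"
      using th_insert_edge[OF A(1)] notin by blast
    obtain a2 where a2: "bedge n (th (insert a Z)) a2 ?w"
      using th_insert_edge[of c "insert a Z"] notin insert.prems(1) swap by auto
    obtain b1 where b1: "bedge n (th Z) b1 (th (insert b Z))"
      using th_insert_edge[OF A(2)] notin by blast
    obtain b2 where b2: "bedge n (th (insert b Z)) b2 ?w"
      using th_insert_edge[of c "insert b Z"] notin insert.prems(2,5) swap by auto
    have "th (insert a Z) \<noteq> th (insert c Z)" "th (insert b Z) \<noteq> th (insert c Z)"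
      using insert.IH[OF A(1,3)] insert.IH[OF A(2,3)] notin insert.hyps by blast+
    then have "th (insert a Z) = th (insert b Z)"
      using diamond_unique[OF t1 t2 a1 a2 _ b1 b2] by blast
    then show False using insert.IH[OF A(1,2)] notin \<open>a \<noteq> b\<close> by blast
  qed
qed

text \<open>A form of (HC4) for two one-element extensions of \<open>Z\<close>; the lower edges come
  from (HC3), and distinctness from the strict growth of length.\<close>

lemma th_diamond:
  assumes A: "insert a Z \<in> A" "insert b Z \<in> A" and Z: "a \<notin> Z" "b \<notin> Z"
    and ne: "th (insert a Z) \<noteq> th (insert b Z)"
    and top: "bedge n (th (insert a Z)) t w" "bedge n (th (insert b Z)) t' w" and w: "w \<in> interval n u v"
  shows "insert b (insert a Z) \<in> A" and "th (insert b (insert a Z)) = w"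
proof -
  let ?Y = "insert a Z" and ?Y' = "insert b Z"
  have ZA: "Z \<in> A" using A_subset[OF A(1)] by blast
  have fin: "finite Z" using A_finite[OF ZA] .
  have "a \<noteq> b" using ne by auto
  then have int: "?Y \<inter> ?Y' = Z" using Z by auto
  obtain t1 where t1: "bedge n (th Z) t1 (th ?Y)" using th_insert_edge[OF A(1) Z(1)] .
  obtain t2 where t2: "bedge n (th Z) t2 (th ?Y')" using th_insert_edge[OF A(2) Z(2)] .
  have "distinct [th Z, th ?Y, th ?Y', w]"
    using ne t1 t2 top by (auto simp: bedge_def)
  then have "diamond n (th Z) (th ?Y) (th ?Y') w"
    using t1 t2 top by (auto simp: diamond_def bedge'_def)
  moreover have "{th Z, th ?Y, th ?Y', w} \<subseteq> interval n u v"
    using th_interval A ZA w by blast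
  moreover have "card ?Y = card ?Y'" "card ?Y = card Z + 1"
    using fin Z by simp_all
  ultimately have "antichain n (?Y \<union> ?Y') \<and> th (?Y \<union> ?Y') = w"
    using cluster A int unfolding strong_hc_cluster_def by (metis (no_types, lifting))
  moreover have "?Y \<union> ?Y' = insert b (insert a Z)" by blast
  ultimately show "insert b (insert a Z) \<in> A" and "th (insert b (insert a Z)) = w"
    using A by (auto simp: Aset_def)
qed

abbreviation cwalk :: "perm set \<Rightarrow> perm list \<Rightarrow> bool" where
  "cwalk \<equiv> cube_walk n A th"

lemma cube_walk_in_A: "cwalk Z ts \<Longrightarrow> Z \<in> A"
  by (induction rule: cube_walk.induct) (simp_all add: empty_in_A)

lemma cube_walk_walk: "cwalk Z ts \<Longrightarrow> walk n x ts (th Z)"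
  by (induction rule: cube_walk.induct) (auto simp: th_empty walk_snoc)

lemma cube_walk_length: "cwalk Z ts \<Longrightarrow> length ts = card Z"
proof (induction rule: cube_walk.induct)
  case (cube_walk_insert Z ts z t)
  then show ?case using A_finite[of "insert z Z"] by simp
qed simp

lemma cube_walk_emptyD: "cwalk {} ts \<Longrightarrow> ts = []"
  using cube_walk_length by fastforce

lemma ideal_up: "w \<notin> I \<Longrightarrow> w \<in> interval n u v \<Longrightarrow> bruhat_le n w w' \<Longrightarrow> w' \<notin> I"
  using ideal unfolding order_ideal_def by blast

lemma cube_walk_outside: "cwalk Z ts \<Longrightarrow> Z \<noteq> {} \<Longrightarrow> th Z \<notin> I"
proof (induction rule: cube_walk.induct)
  case (cube_walk_insert Z ts z t)
  show ?case
  proof (cases "Z = {}")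
    case True
    then show ?thesis
      using cube_walk_insert.hyps(3) th_singleton[of z] by (auto simp: Aset_def Yset_def)
  next
    case False
    have "Z \<in> A" using cube_walk_in_A cube_walk_insert.hyps(1) .
    then show ?thesis
      using ideal_up[OF cube_walk_insert.IH[OF False] th_interval]
        bedge_bruhat_le[OF cube_walk_insert.hyps(4)] by blast
  qed
qed simp

text \<open>A cluster path leaves \<open>I\<close> with its first step and never returns. This makes
  the cut vertex of a concatenated path recoverable.\<close>

lemma cube_walk_prefix_outside:
  "cwalk Z ts \<Longrightarrow> ts = us @ us' \<Longrightarrow> us \<noteq> [] \<Longrightarrow> walk n x us w \<Longrightarrow> w \<notin> I"
proof (induction arbitrary: us' rule: cube_walk.induct)
  case (cube_walk_insert Z ts z t)
  show ?case
  proof (cases "us' = []")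
    case True
    have c: "cwalk (insert z Z) (ts @ [t])"
      using cube_walk.cube_walk_insert cube_walk_insert.hyps by blast
    then have "w = th (insert z Z)"
      using walk_deterministic[OF cube_walk_insert.prems(3)] cube_walk_walk[OF c]
        cube_walk_insert.prems(1) True by simp
    then show ?thesis using cube_walk_outside[OF c] by simp
  next
    case False
    then have "ts = us @ butlast us'"
      using cube_walk_insert.prems(1) by (metis butlast_append butlast_snoc)
    then show ?thesis using cube_walk_insert by blast
  qed
qed simp

lemma cube_walk_deterministic: "cwalk Y ts \<Longrightarrow> cwalk Y' ts \<Longrightarrow> Y = Y'"
proof (induction arbitrary: Y' rule: cube_walk.induct)
  case cube_walk_empty
  then show ?case using cube_walk_length A_finite cube_walk_in_A
    by (metis card_0_eq list.size(3))
next
  case (cube_walk_insert Z ts z t)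
  from cube_walk_insert.prems obtain Z' z' where Y': "Y' = insert z' Z'" "cwalk Z' ts" "z' \<notin> Z'"
    "insert z' Z' \<in> A" "bedge n (th Z') t (th (insert z' Z'))"
    by (cases rule: cube_walk.cases) auto
  then have "Z = Z'" using cube_walk_insert.IH by blast
  moreover have "th (insert z Z) = th (insert z' Z')"
    using cube_walk_insert.hyps(4) Y'(5) \<open>Z = Z'\<close> by (simp add: bedge_def)
  ultimately show ?case
    using th_insert_inj[of Z z z'] cube_walk_insert.hyps Y' A_finite[of Z] cube_walk_in_A by simp
qed

text \<open>One-element extensions of \<open>Z\<close> have different images, so the square of sets
  maps to a genuine diamond and the comparison of labels in diamonds applies.\<close>

lemma cube_square_order:
  assumes Y: "insert z (insert z' Z) \<in> A" and Z: "z \<notin> Z" "z' \<notin> Z" "z \<noteq> z'"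
    and t: "bedge n (th Z) t0 (th (insert z' Z))"
      "bedge n (th (insert z' Z)) t (th (insert z (insert z' Z)))"
      "bedge n (th (insert z Z)) r (th (insert z (insert z' Z)))"
  shows "prec t0 t \<longleftrightarrow> prec r t" and "r \<noteq> t"
proof -
  have A: "insert z Z \<in> A" "insert z' Z \<in> A" "Z \<in> A" using A_subset[OF Y] by blast+
  obtain s where s: "bedge n (th Z) s (th (insert z Z))" using th_insert_edge[OF A(1) Z(1)] .
  have ne: "th (insert z Z) \<noteq> th (insert z' Z)"
    using th_insert_inj[OF A_finite[OF A(3)] A(1,2) Z(1,2)] Z(3) by blast
  show "prec t0 t \<longleftrightarrow> prec r t" by (rule diamond_order(2)[OF t(1,2) s t(3) ne])
  show "r \<noteq> t"
    using ne t(2,3) Trans_involution[of t n] by (metis bedge_def)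
qed

text \<open>For \<open>z\<close> other than the last element inserted, the label of the edge that
  adds \<open>z\<close> one level lower is at most the preceding label by induction, hence below the
  last one; the square then transfers this to \<open>r\<close>.\<close>

lemma cube_walk_last_max:
  "cwalk Y ts \<Longrightarrow> sorted_wrt prec ts \<Longrightarrow> z \<in> Y \<Longrightarrow> bedge n (th (Y - {z})) r (th Y) \<Longrightarrow>
    r = last ts \<or> prec r (last ts)"
proof (induction arbitrary: z r rule: cube_walk.induct)
  case (cube_walk_insert Z ts z0 t)
  show ?case
  proof (cases "z = z0")
    case True
    then show ?thesis
      using cube_walk_insert.prems(3) cube_walk_insert.hyps(2,4) bedge_label_unique by auto
  next
    case False
    then have zZ: "z \<in> Z" using cube_walk_insert.prems(2) by simp
    define Z' where "Z' = Z - {z}"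
    have Z: "Z = insert z Z'" and Z': "z \<notin> Z'" "z0 \<notin> Z'"
      using zZ cube_walk_insert.hyps(2) by (auto simp: Z'_def)
    have ZA: "insert z Z' \<in> A" using cube_walk_in_A[OF cube_walk_insert.hyps(1)] Z by simp
    obtain t0 where t0: "bedge n (th Z') t0 (th Z)"
      using th_insert_edge[OF ZA Z'(1)] Z by metis
    have T: "t0 \<in> Trans n" "t \<in> Trans n" "set ts \<subseteq> Trans n"
      using t0 cube_walk_insert.hyps walk_Trans[OF cube_walk_walk] by (auto simp: bedge_def)
    have "ts \<noteq> []" using cube_walk_length[OF cube_walk_insert.hyps(1)] zZ
        A_finite[OF cube_walk_in_A[OF cube_walk_insert.hyps(1)]] by auto
    then have lt: "last ts \<in> Trans n" "prec (last ts) t"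
      using T cube_walk_insert.prems(1) by (auto simp: sorted_wrt_append)
    have "t0 = last ts \<or> prec t0 (last ts)"
      using cube_walk_insert.IH[OF _ zZ] t0 cube_walk_insert.prems(1)
      by (simp add: Z'_def sorted_wrt_append)
    then have "prec t0 t" using lt T prec_trans by blast
    moreover have "insert z0 Z - {z} = insert z0 Z'" using False by (auto simp: Z'_def)
    ultimately have "prec r t"
      using cube_square_order(1)[of z0 z Z' t0 t r] cube_walk_insert.hyps cube_walk_insert.prems(3)
        t0 Z' False unfolding Z by auto
    then show ?thesis by simp
  qed
qed simp

text \<open>The final label of an increasing path is the greatest label entering \<open>th Y\<close>
  from a facet of \<open>Y\<close>. Two such paths thus end with the same label, hence come from the
  same vertex, and by injectivity on one-element extensions from the same subset.\<close>

lemma cube_walk_unique: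
  "cwalk Y ts \<Longrightarrow> cwalk Y ts' \<Longrightarrow> sorted_wrt prec ts \<Longrightarrow> sorted_wrt prec ts' \<Longrightarrow> ts = ts'"
proof (induction arbitrary: ts' rule: cube_walk.induct)
  case cube_walk_empty
  then show ?case using cube_walk_emptyD[of ts'] by simp
next
  case (cube_walk_insert Z ts z t)
  from cube_walk_insert.prems(1) obtain Z' ts'' z' t' where Y': "insert z Z = insert z' Z'"
    "ts' = ts'' @ [t']" "cwalk Z' ts''" "z' \<notin> Z'" "bedge n (th Z') t' (th (insert z' Z'))"
    by (cases rule: cube_walk.cases) auto
  have c: "cwalk (insert z Z) (ts @ [t])"
    using cube_walk.cube_walk_insert cube_walk_insert.hyps by blast
  have D: "insert z Z - {z} = Z" "insert z Z - {z'} = Z'"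
    using cube_walk_insert.hyps(2) Y'(1,4) by blast+
  have e': "bedge n (th (insert z Z - {z'})) t' (th (insert z Z))"
    using Y'(5) unfolding D(2) Y'(1)[symmetric] .
  have e: "bedge n (th (insert z Z - {z})) t (th (insert z Z))"
    using cube_walk_insert.hyps(4) unfolding D(1) .
  have mem: "z' \<in> insert z Z" unfolding Y'(1) by simp
  have T: "t \<in> Trans n" "t' \<in> Trans n" using cube_walk_insert.hyps(4) Y'(5) by (auto simp: bedge_def)
  have "t' = t \<or> prec t' t"
    using cube_walk_last_max[OF c cube_walk_insert.prems(2) mem e'] by simp
  moreover have "t = t' \<or> prec t t'"
    using cube_walk_last_max[OF cube_walk_insert.prems(1,3) _ e] Y'(2) by simp
  ultimately have "t = t'" using prec_asym T by blast
  have "th Z = t \<circ> th (insert z Z)" "th Z' = t' \<circ> th (insert z Z)"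
    using Trans_involution[OF T(1), of "th Z"] Trans_involution[OF T(2), of "th Z'"] e e'
    unfolding D by (simp_all add: bedge_def)
  then have eq: "th Z = th Z'" using \<open>t = t'\<close> by simp
  have "z = z'"
  proof (rule ccontr)
    assume ne: "z \<noteq> z'"
    define V where "V = insert z Z - {z, z'}"
    have ZV: "Z = insert z' V" "Z' = insert z V" "z \<notin> V" "z' \<notin> V"
      using ne mem D unfolding V_def by blast+
    have "Z \<in> A" "Z' \<in> A" using cube_walk_in_A cube_walk_insert.hyps(1) Y'(3) by blast+
    then have "z' = z"
      using th_insert_inj[of V z' z] A_finite[of Z] ZV(3,4) eq unfolding ZV(1,2) by simp
    then show False using ne by simp
  qed
  then have "Z = Z'" using D by metis
  then show ?case
    using cube_walk_insert.IH[of ts''] Y' cube_walk_insert.prems \<open>t = t'\<close>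
    by (simp add: sorted_wrt_append)
qed

text \<open>The last element inserted is one whose edge into \<open>th Y\<close> has the greatest
  label; the rest is an increasing path for the smaller set.\<close>

lemma increasing_cube_walk_exists:
  "Y \<in> A \<Longrightarrow> \<exists>ts. cwalk Y ts \<and> sorted_wrt prec ts"
proof (induction "card Y" arbitrary: Y)
  case 0
  then have "Y = {}" using A_finite by auto
  then show ?case using cube_walk_empty by fastforce
next
  case (Suc k)
  have fin: "finite Y" using A_finite Suc.prems .
  define L where "L = {t. \<exists>z\<in>Y. bedge n (th (Y - {z})) t (th Y)}"
  have edge: "\<exists>t. bedge n (th (Y - {z})) t (th Y)" if "z \<in> Y" for z
    using th_insert_edge[of z "Y - {z}"] Suc.prems that by (metis Diff_iff insertI1 insert_Diff)
  have LT: "L \<subseteq> Trans n" by (auto simp: L_def bedge_def)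
  have "Y \<noteq> {}" using Suc.hyps(2) by auto
  then have "L \<noteq> {}" using edge by (auto simp: L_def)
  then obtain t where t: "t \<in> L" "\<And>t'. t' \<in> L \<Longrightarrow> t' \<noteq> t \<Longrightarrow> prec t' t"
    using ex_prec_max[OF finite_subset[OF LT finite_Trans] _ LT] by blast
  then obtain z where z: "z \<in> Y" "bedge n (th (Y - {z})) t (th Y)" by (auto simp: L_def)
  define Z where "Z = Y - {z}"
  have Y: "Y = insert z Z" "z \<notin> Z" using z by (auto simp: Z_def)
  have "Z \<in> A" using A_subset[OF Suc.prems] by (auto simp: Z_def)
  moreover have "k = card Z" using Suc.hyps(2) fin Y by simp
  ultimately obtain ts where ts: "cwalk Z ts" "sorted_wrt prec ts" using Suc.hyps(1) by blast
  have tZ: "bedge n (th Z) t (th (insert z Z))"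
    using z(2) unfolding Z_def[symmetric] Y(1)[symmetric] .
  have c: "cwalk Y (ts @ [t])"
    using cube_walk_insert[OF ts(1) Y(2) _ tZ] Suc.prems unfolding Y(1)[symmetric] .
  \<comment> \<open>Exchanging the last two insertions gives another edge into \<open>th Y\<close>,
    with label \<open>r\<close> below the maximal \<open>t\<close>; the square turns this into the
    ascent from \<open>t0\<close> to \<open>t\<close>.\<close>
  have last: "prec (last ts) t" if "ts \<noteq> []"
  proof -
    from ts(1) that obtain Z0 z0 ts0 t0 where Z0: "Z = insert z0 Z0" "z0 \<notin> Z0" "ts = ts0 @ [t0]"
      "bedge n (th Z0) t0 (th (insert z0 Z0))"
      by (cases rule: cube_walk.cases) auto
    have "z0 \<in> Y" "Y - {z0} = insert z Z0" using Y Z0(1,2) by blast+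
    then obtain r where r: "bedge n (th (insert z Z0)) r (th Y)" using edge[of z0] by metis
    then have "bedge n (th (Y - {z0})) r (th Y)" unfolding \<open>Y - {z0} = insert z Z0\<close> .
    then have "r \<in> L" unfolding L_def using \<open>z0 \<in> Y\<close> by blast
    have sq: "insert z (insert z0 Z0) \<in> A" "z \<notin> Z0" "z \<noteq> z0"
      using Suc.prems Y(2) unfolding Y(1) Z0(1) by auto
    have "r \<noteq> t" "prec t0 t \<longleftrightarrow> prec r t"
      using cube_square_order[OF sq(1,2) Z0(2) sq(3) Z0(4)] tZ r unfolding Y(1) Z0(1) by blast+
    then show ?thesis using t(2)[OF \<open>r \<in> L\<close>] Z0(3) by simp
  qed
  have T: "set (ts @ [t]) \<subseteq> Trans n" using walk_Trans[OF cube_walk_walk[OF c]] .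
  have "prec t' t" if "t' \<in> set ts" for t'
  proof -
    have ne: "ts \<noteq> []" using that by auto
    then have "t' = last ts \<or> prec t' (last ts)"
      using ts(2) that by (cases ts rule: rev_cases) (auto simp: sorted_wrt_append)
    moreover have "last ts \<in> Trans n" "t' \<in> Trans n" "t \<in> Trans n" using T ne that by auto
    ultimately show ?thesis using last[OF ne] prec_trans by blast
  qed
  then show ?case using c ts(2) by (auto simp: sorted_wrt_append)
qed

text \<open>
  Flipping the last square of an increasing path yields another increasing path of the same length
  from the cluster, so condition (HC4) applies; (E1) keeps the flipped vertex outside \<open>I\<close>.
\<close>

lemma cube_walk_extend:
  assumes E1: "condE1 n u v I prec"
  shows "cwalk Z ts \<Longrightarrow> sorted_wrt prec (ts @ [t]) \<Longrightarrow> bedge n (th Z) t w \<Longrightarrow>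
    w \<in> interval n u v - I \<Longrightarrow> \<exists>z. z \<notin> Z \<and> insert z Z \<in> A \<and> th (insert z Z) = w"
proof (induction arbitrary: t w rule: cube_walk.induct)
  case cube_walk_empty
  then have "w \<in> Yset n u v I x" by (auto simp: Yset_def bedge'_def th_empty)
  then have "{w} \<in> A" by (simp add: Aset_def antichain_def)
  then show ?case using th_singleton by (intro exI[of _ w]) simp
next
  case (cube_walk_insert Z ts z0 t0)
  let ?Y = "insert z0 Z"
  have c: "cwalk ?Y (ts @ [t0])"
    using cube_walk.cube_walk_insert cube_walk_insert.hyps by blast
  have ZA: "Z \<in> A" using cube_walk_in_A cube_walk_insert.hyps(1) .
  obtain d1 y d2 where y: "y \<noteq> th ?Y" "bedge n (th Z) d1 y" "bedge n y d2 w"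
    using diamond_exists[OF cube_walk_insert.hyps(4) cube_walk_insert.prems(2)] .
  have T: "t0 \<in> Trans n" "d1 \<in> Trans n" "set ts \<subseteq> Trans n"
    using cube_walk_insert.hyps y walk_Trans[OF cube_walk_walk] by (auto simp: bedge_def)
  have "prec t0 t" using cube_walk_insert.prems(1) by (simp add: sorted_wrt_append)
  then have t0d1: "prec t0 d1"
    using diamond_order(1)[OF cube_walk_insert.hyps(4) cube_walk_insert.prems(2) y(2,3,1)] by simp
  have sorted: "sorted_wrt prec (ts @ [d1])"
  proof -
    have "prec t' d1" if "t' \<in> set ts" for t'
    proof -
      have "prec t' t0" using cube_walk_insert.prems(1) that by (simp add: sorted_wrt_append)
      then show ?thesis using prec_trans[OF _ t0d1] T that by blast
    qed
    then show ?thesis using cube_walk_insert.prems(1) by (simp add: sorted_wrt_append)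
  qed
  have y_int: "y \<in> interval n u v"
    using th_interval[OF ZA] cube_walk_insert.prems(3) bedge_bruhat_le[OF y(2)] bedge_bruhat_le[OF y(3)]
    by (auto simp: interval_def intro: bruhat_le_trans)
  have "y \<notin> I"
  \<comment> \<open>Once the path has left \<open>I\<close>, so has \<open>y\<close>. At
    \<open>x\<close> itself, \<open>y \<in> I\<close> would by (E1) put \<open>d1\<close> before
    \<open>t0\<close>, against the direction given by the diamond.\<close>
  proof (cases "Z = {}")
    case True
    have "th ?Y \<in> interval n u v - I"
      using th_interval[OF cube_walk_insert.hyps(3)] cube_walk_outside[OF c] by simp
    then have "y \<in> I \<Longrightarrow> prec d1 t0"
      using E1 x_in y(2) cube_walk_insert.hyps(4) th_empty True unfolding condE1_def by metis
    then show ?thesis using prec_asym[OF t0d1] T by blast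
  next
    case False
    then show ?thesis
      using ideal_up[OF cube_walk_outside[OF cube_walk_insert.hyps(1)] th_interval[OF ZA]]
        bedge_bruhat_le[OF y(2)] by blast
  qed
  then obtain z where z: "z \<notin> Z" "insert z Z \<in> A" "th (insert z Z) = y"
    using cube_walk_insert.IH[OF sorted y(2)] y_int by blast
  have "insert z ?Y \<in> A" "th (insert z ?Y) = w"
    using th_diamond[OF cube_walk_insert.hyps(3) z(2) cube_walk_insert.hyps(2) z(1)]
      y(1,3) z(3) cube_walk_insert.prems(2,3) by auto
  moreover have "z \<notin> ?Y" using z y(1) by auto
  ultimately show ?case by blast
qed

end

section \<open>Hypercube decompositions\<close>

lemma coeff_sum_monom:
  assumes "finite S"
  shows "coeff (\<Sum>s\<in>S. monom (1::int) (f s)) i = int (card {s \<in> S. f s = i})"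
proof -
  have "coeff (\<Sum>s\<in>S. monom (1::int) (f s)) i = (\<Sum>s\<in>S. if f s = i then 1 else 0)"
    by (simp add: coeff_sum)
  also have "\<dots> = (\<Sum>s\<in>{s \<in> S. f s = i}. 1)" by (rule sum.inter_filter[OF assms, symmetric])
  finally show ?thesis by simp
qed

lemma poly_le_sum_monom:
  assumes fin: "finite S'" and inj: "inj_on g S" and img: "g ` S \<subseteq> S'"
    and deg: "\<And>s. s \<in> S \<Longrightarrow> f' (g s) = f s"
  shows "poly_le (\<Sum>s\<in>S. monom 1 (f s)) (\<Sum>s\<in>S'. monom 1 (f' s))"
  unfolding poly_le_def
proof
  fix i
  have finS: "finite S" using finite_imageD[OF finite_subset[OF img fin] inj] .
  have "card {s \<in> S. f s = i} \<le> card {s \<in> S'. f' s = i}"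
    using fin img deg by (intro card_inj_on_le[of g] inj_on_subset[OF inj]) auto
  then show "coeff (\<Sum>s\<in>S. monom (1::int) (f s)) i \<le> coeff (\<Sum>s\<in>S'. monom 1 (f' s)) i"
    by (simp add: coeff_sum_monom finS fin)
qed

locale hc_decomposition = refl_order +
  fixes u v :: perm and I :: "perm set" and th :: "perm \<Rightarrow> perm set \<Rightarrow> perm"
  assumes u: "u \<in> Sn n" and v: "v \<in> Sn n"
    and decomp: "strong_hc_decomp n u v I"
    and clusters: "\<And>x. x \<in> I \<Longrightarrow> strong_hc_cluster n u v I x (th x)"
begin

lemma ideal: "order_ideal n u v I"
  using decomp by (simp add: strong_hc_decomp_def)

lemma I_interval: "x \<in> I \<Longrightarrow> x \<in> interval n u v"
  using ideal by (auto simp: order_ideal_def)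

lemma I_Sn: "x \<in> I \<Longrightarrow> x \<in> Sn n"
  using I_interval by (auto simp: interval_def dest: bruhat_le_Sn)

lemma u_in_I: "u \<in> I"
  using decomp u unfolding strong_hc_decomp_def interval_def by (auto intro: bruhat_le_refl)

lemma finite_I: "finite I"
  by (rule finite_subset[OF _ finite_Sn]) (auto intro: I_Sn)

lemma hc_cluster: "x \<in> I \<Longrightarrow> hc_cluster n prec u v I x (th x)"
  using ideal clusters by unfold_locales auto

abbreviation walks :: "perm \<Rightarrow> perm list set" where
  "walks w \<equiv> increasing_walks n prec (Trans n) u w"

abbreviation cwalk :: "perm \<Rightarrow> perm set \<Rightarrow> perm list \<Rightarrow> bool" where
  "cwalk x \<equiv> cube_walk n (Aset n u v I x) (th x)"

lemma walks_iff: "ts \<in> walks w \<longleftrightarrow> sorted_wrt prec ts \<and> walk n u ts w"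
  by (auto simp: increasing_walks_def dest: walk_Trans)

text \<open>The index set of \<open>Htilde\<close> after Dyer's formula has replaced
  \<open>Rtilde n u x\<close> by a sum over increasing paths from \<open>u\<close> to
  \<open>x\<close>, the third component.\<close>

definition hc_triples :: "(perm \<times> perm set \<times> perm list) set" where
  "hc_triples = (SIGMA x:I. {Y \<in> Aset n u v I x. th x Y = v} \<times> walks x)"

lemma finite_Aset: "finite (Aset n u v I x)"
proof (rule finite_subset)
  show "Aset n u v I x \<subseteq> Pow (Sn n)"
    by (auto simp: Aset_def Yset_def interval_def dest: bruhat_le_Sn)
qed (simp add: finite_Sn)

lemma finite_hc_triples: "finite hc_triples"
  unfolding hc_triples_def
  by (intro finite_SigmaI finite_cartesian_product finite_I)
    (simp_all add: finite_Aset finite_increasing_walks)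

lemma Rtilde_eq: "w \<in> Sn n \<Longrightarrow> Rtilde n u w = (\<Sum>ts\<in>walks w. monom 1 (length ts))"
  using Rtilde_eq_walk_poly[OF u] by (simp add: walk_poly_def)

lemma Htilde_eq: "Htilde n u v I th = (\<Sum>(x, Y, ts)\<in>hc_triples. monom 1 (card Y + length ts))"
proof -
  have "(\<Sum>Y\<in>{Y \<in> Aset n u v I x. th x Y = v}. monom 1 (card Y) * Rtilde n u x) =
      (\<Sum>(Y, ts)\<in>{Y \<in> Aset n u v I x. th x Y = v} \<times> walks x. monom 1 (card Y + length ts))"
    if "x \<in> I" for x
    using Rtilde_eq[OF I_Sn[OF that]]
    by (simp add: sum.cartesian_product[symmetric] sum_distrib_left mult_monom)
  then have "Htilde n u v I th = (\<Sum>x\<in>I. \<Sum>(Y, ts)\<in>{Y \<in> Aset n u v I x. th x Y = v} \<times> walks x.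
      monom 1 (card Y + length ts))"
    unfolding Htilde_def by (rule sum.cong[OF refl])
  also have "\<dots> = (\<Sum>(x, Y, ts)\<in>hc_triples. monom 1 (card Y + length ts))"
    unfolding hc_triples_def using finite_I finite_Aset finite_increasing_walks
    by (subst sum.Sigma) auto
  finally show ?thesis .
qed

lemma increasing_walk_split:
  assumes E1: "condE1 n u v I prec"
  shows "sorted_wrt prec ts \<Longrightarrow> walk n u ts w \<Longrightarrow> bruhat_le n w v \<Longrightarrow>
    \<exists>ts1 ts2 x Y. ts = ts1 @ ts2 \<and> walk n u ts1 x \<and> x \<in> I \<and> cwalk x Y ts2 \<and> th x Y = w"
proof (induction ts arbitrary: w rule: rev_induct)
  case Nil
  interpret C: hc_cluster n prec u v I u "th u" by (rule hc_cluster[OF u_in_I])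
  show ?case
    using Nil u_in_I cube_walk_empty[of n "Aset n u v I u" "th u"] C.th_empty by force
next
  case (snoc t ts)
  then obtain w' where w': "walk n u ts w'" "bedge n w' t w" by (auto simp: walk_snoc)
  have le: "bruhat_le n u w'" "bruhat_le n u w" using walk_bruhat_le[OF u] w'(1) snoc.prems(2) by blast+
  have "bruhat_le n w' v" using bruhat_le_trans[OF bedge_bruhat_le[OF w'(2)] snoc.prems(3)] .
  then obtain ts1 ts2 x Y where s: "ts = ts1 @ ts2" "walk n u ts1 x" "x \<in> I" "cwalk x Y ts2" "th x Y = w'"
    using snoc.IH[of w'] snoc.prems(1) w'(1) by (auto simp: sorted_wrt_append)
  show ?case
  proof (cases "w \<in> I")
    \<comment> \<open>The splitting found so far is discarded and the whole list becomes the prefix,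
      so the cut is the last visit to \<open>I\<close>.\<close>
    case True
    interpret C: hc_cluster n prec u v I w "th w" by (rule hc_cluster[OF True])
    show ?thesis
      using True snoc.prems(2) cube_walk_empty[of n "Aset n u v I w" "th w"] C.th_empty
      by (intro exI[of _ "ts @ [t]"] exI[of _ "[]"] exI[of _ w] exI[of _ "{}"]) simp
  next
    case False
    interpret C: hc_cluster n prec u v I x "th x" by (rule hc_cluster[OF s(3)])
    have w_int: "w \<in> interval n u v - I" using False le(2) snoc.prems(3) by (simp add: interval_def)
    have sorted: "sorted_wrt prec (ts2 @ [t])"
      using snoc.prems(1) s(1) by (simp add: sorted_wrt_append)
    obtain z where z: "z \<notin> Y" "insert z Y \<in> Aset n u v I x" "th x (insert z Y) = w"
      using C.cube_walk_extend[OF E1 s(4) sorted _ w_int] w'(2) s(5) by auto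
    have "cwalk x (insert z Y) (ts2 @ [t])"
      using cube_walk_insert[OF s(4) z(1,2)] w'(2) s(5) z(3) by auto
    then show ?thesis using s z(3)
      by (intro exI[of _ ts1] exI[of _ "ts2 @ [t]"] exI[of _ x] exI[of _ "insert z Y"]) simp
  qed
qed

text \<open>A path is sent to its cut vertex, the antichain of its tail and its initial part.
  Nothing is lost, since the tail is the only increasing cluster path over that antichain.\<close>

lemma Rtilde_le_Htilde:
  assumes E1: "condE1 n u v I prec"
  shows "poly_le (Rtilde n u v) (Htilde n u v I th)"
proof -
  define split where "split = (\<lambda>ts (x, Y, ts1). \<exists>ts2. ts = ts1 @ ts2 \<and> walk n u ts1 x \<and> x \<in> I \<and>
    cwalk x Y ts2 \<and> th x Y = v \<and> sorted_wrt prec ts)"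
  define g where "g = (\<lambda>ts. SOME p. split ts p)"
  have g: "split ts (g ts)" if ts: "ts \<in> walks v" for ts
  proof -
    have "\<exists>p. split ts p"
      using increasing_walk_split[OF E1, of ts v] ts bruhat_le_refl[OF v]
      unfolding walks_iff split_def by fastforce
    then show ?thesis unfolding g_def by (rule someI_ex)
  qed
  have "inj_on g (walks v)"
  proof (rule inj_onI)
    fix ts ts' assume ts: "ts \<in> walks v" "ts' \<in> walks v" and eq: "g ts = g ts'"
    obtain x Y ts1 where p: "g ts = (x, Y, ts1)" by (cases "g ts")
    from g[OF ts(1)] p obtain ts2 where s: "ts = ts1 @ ts2" "x \<in> I" "cwalk x Y ts2" "sorted_wrt prec ts"
      by (auto simp: split_def)
    from g[OF ts(2)] p eq obtain ts2' where s': "ts' = ts1 @ ts2'" "cwalk x Y ts2'" "sorted_wrt prec ts'"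
      by (auto simp: split_def)
    interpret C: hc_cluster n prec u v I x "th x" by (rule hc_cluster[OF s(2)])
    have "ts2 = ts2'"
      using C.cube_walk_unique[OF s(3) s'(2)] s s' by (simp add: sorted_wrt_append)
    then show "ts = ts'" using s s' by simp
  qed
  moreover have "g ts \<in> hc_triples \<and> (case g ts of (x, Y, ts1) \<Rightarrow> card Y + length ts1) = length ts"
    if ts: "ts \<in> walks v" for ts
  proof -
    obtain x Y ts1 where p: "g ts = (x, Y, ts1)" by (cases "g ts")
    from g[OF ts] p obtain ts2 where s: "ts = ts1 @ ts2" "walk n u ts1 x" "x \<in> I" "cwalk x Y ts2"
      "th x Y = v" "sorted_wrt prec ts"
      by (auto simp: split_def)
    interpret C: hc_cluster n prec u v I x "th x" by (rule hc_cluster[OF s(3)])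
    show ?thesis
      using s p C.cube_walk_in_A[OF s(4)] C.cube_walk_length[OF s(4)]
      by (simp add: hc_triples_def walks_iff sorted_wrt_append)
  qed
  ultimately show ?thesis
    unfolding Rtilde_eq[OF v] Htilde_eq case_prod_unfold
    by (intro poly_le_sum_monom[of _ g] finite_hc_triples) (auto simp: case_prod_unfold)
qed

text \<open>Each triple is sent to its path followed by the increasing cluster path
  \<open>c x Y\<close>. Vertex, antichain and initial part can all be read off again from the
  result.\<close>

lemma Htilde_le_Rtilde:
  assumes E2: "condE2 n u v I prec"
  shows "poly_le (Htilde n u v I th) (Rtilde n u v)"
proof -
  define c where "c = (\<lambda>x Y. SOME ts. cwalk x Y ts \<and> sorted_wrt prec ts)"
  have c: "cwalk x Y (c x Y)" "sorted_wrt prec (c x Y)"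
    if "x \<in> I" "Y \<in> Aset n u v I x" for x Y
  proof -
    interpret C: hc_cluster n prec u v I x "th x" by (rule hc_cluster[OF that(1)])
    have "cwalk x Y (c x Y) \<and> sorted_wrt prec (c x Y)"
      unfolding c_def by (rule someI_ex[OF C.increasing_cube_walk_exists[OF that(2)]])
    then show "cwalk x Y (c x Y)" "sorted_wrt prec (c x Y)" by blast+
  qed
  define g where "g = (\<lambda>(x, Y, ts). ts @ c x Y)"
  have triple: "x \<in> I" "Y \<in> Aset n u v I x" "th x Y = v" "sorted_wrt prec ts" "walk n u ts x"
    if "(x, Y, ts) \<in> hc_triples" for x Y ts
    using that by (auto simp: hc_triples_def walks_iff)
  have img: "g (x, Y, ts) \<in> walks v \<and> length (g (x, Y, ts)) = card Y + length ts"
    if "(x, Y, ts) \<in> hc_triples" for x Y ts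
  proof -
    note tr = triple[OF that]
    interpret C: hc_cluster n prec u v I x "th x" by (rule hc_cluster[OF tr(1)])
    note cY = c[OF tr(1,2)]
    have walk_c: "walk n x (c x Y) v" using C.cube_walk_walk[OF cY(1)] tr(3) by simp
    have T: "set ts \<subseteq> Trans n" "set (c x Y) \<subseteq> Trans n"
      using walk_Trans tr(5) walk_c by blast+
    \<comment> \<open>(E2) compares the two labels adjacent to \<open>x\<close>; transitivity along
      the two increasing parts gives all other comparisons.\<close>
    have "prec r s" if r: "r \<in> set ts" and s: "s \<in> set (c x Y)" for r s
    proof -
      obtain ts0 r0 where ts: "ts = ts0 @ [r0]" using r by (cases ts rule: rev_cases) auto
      obtain s0 ss where ss: "c x Y = s0 # ss" using s by (cases "c x Y") auto
      obtain y1 where y1: "walk n u ts0 y1" "bedge n y1 r0 x" using tr(5) ts by (auto simp: walk_snoc)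
      have y1_int: "y1 \<in> interval n u v"
        using walk_bruhat_le[OF u y1(1)] bedge_bruhat_le[OF y1(2)] I_interval[OF tr(1)]
        by (auto simp: interval_def intro: bruhat_le_trans)
      then have "y1 \<in> I"
        using ideal tr(1) bedge_bruhat_le[OF y1(2)] unfolding order_ideal_def by blast
      have e: "bedge n x s0 (s0 \<circ> x)" "walk n (s0 \<circ> x) ss v" using walk_c ss by auto
      have "s0 \<circ> x \<notin> I"
        using C.cube_walk_prefix_outside[OF cY(1), of "[s0]" ss] ss e(1) by simp
      moreover have "s0 \<circ> x \<in> interval n u v"
        using walk_bruhat_le[OF bedge_Sn(2)[OF e(1)] e(2)] bedge_bruhat_le[OF e(1)] I_interval[OF tr(1)]
        by (auto simp: interval_def intro: bruhat_le_trans)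
      ultimately have r0s0: "prec r0 s0"
        using E2 tr(1) y1(2) e(1) \<open>y1 \<in> I\<close> unfolding condE2_def by blast
      have "r = r0 \<or> prec r r0" using tr(4) r ts by (auto simp: sorted_wrt_append)
      moreover have "s = s0 \<or> prec s0 s" using cY(2) s ss by auto
      moreover have "r \<in> Trans n" "r0 \<in> Trans n" "s0 \<in> Trans n" "s \<in> Trans n"
        using T r s ts ss by auto
      ultimately show ?thesis using r0s0 prec_trans by blast
    qed
    then have "sorted_wrt prec (ts @ c x Y)" using tr(4) cY(2) by (simp add: sorted_wrt_append)
    then show ?thesis
      using tr(5) walk_c C.cube_walk_length[OF cY(1)] by (auto simp: g_def walks_iff walk_append)
  qed
  \<comment> \<open>The overlap \<open>us\<close> is an initial piece of the cluster path at
    \<open>x'\<close> and ends at \<open>x \<in> I\<close>. Since such a path leaves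
    \<open>I\<close> at once, \<open>us\<close> is empty.\<close>
  have same: "(x, Y, ts) = (x', Y', ts')"
    if p: "(x, Y, ts) \<in> hc_triples" "(x', Y', ts') \<in> hc_triples"
      and app: "ts = ts' @ us" "us @ c x Y = c x' Y'" for x Y ts x' Y' ts' us
  proof -
    note tr = triple[OF p(1)] and tr' = triple[OF p(2)]
    interpret C: hc_cluster n prec u v I x' "th x'" by (rule hc_cluster[OF tr'(1)])
    note cY = c[OF tr(1,2)] and cY' = c[OF tr'(1,2)]
    have "walk n x' us x"
      using tr(5) tr'(5) walk_deterministic unfolding app(1) walk_append by blast
    then have "us = []"
      using C.cube_walk_prefix_outside[OF cY'(1) app(2)[symmetric]] tr(1) by blast
    then have "ts = ts'" "x = x'" using app tr(5) tr'(5) walk_deterministic by auto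
    moreover have "Y = Y'"
      using C.cube_walk_deterministic[of Y "c x Y" Y'] cY(1) cY'(1) app(2) \<open>us = []\<close> \<open>x = x'\<close> by simp
    ultimately show ?thesis by simp
  qed
  have "inj_on g hc_triples"
  proof (rule inj_onI)
    fix p p' assume p: "p \<in> hc_triples" "p' \<in> hc_triples" and eq: "g p = g p'"
    obtain x Y ts where x: "p = (x, Y, ts)" by (cases p)
    obtain x' Y' ts' where x': "p' = (x', Y', ts')" by (cases p')
    have "ts @ c x Y = ts' @ c x' Y'" using eq x x' by (simp add: g_def)
    then obtain us where "ts = ts' @ us \<and> us @ c x Y = c x' Y' \<or> ts @ us = ts' \<and> c x Y = us @ c x' Y'"
      by (auto simp: append_eq_append_conv2)
    then show "p = p'"
      using same[of x Y ts x' Y' ts' us] same[of x' Y' ts' x Y ts us] p x x' by fastforce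
  qed
  then show ?thesis
    unfolding Rtilde_eq[OF v] Htilde_eq case_prod_unfold
    using img by (intro poly_le_sum_monom[of _ g] finite_increasing_walks) force+
qed

end

theorem theorem3p9:
  fixes n :: nat and u v :: perm and I :: "perm set" and th :: "perm \<Rightarrow> perm set \<Rightarrow> perm"
  assumes "u \<in> Sn n" and "v \<in> Sn n" and "bruhat_le n u v"
    and "strong_hc_decomp n u v I"
    and "\<forall>x \<in> I. strong_hc_cluster n u v I x (th x)"
  shows "((\<exists>prec. reflection_order n prec \<and> condE1 n u v I prec) \<longrightarrow>
            poly_le (Rtilde n u v) (Htilde n u v I th))
       \<and> ((\<exists>prec. reflection_order n prec \<and> condE2 n u v I prec) \<longrightarrow>
            poly_le (Htilde n u v I th) (Rtilde n u v))
       \<and> ((\<exists>prec. reflection_order n prec \<and> condE n u v I prec) \<longrightarrow>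
            Rtilde n u v = Htilde n u v I th)"
proof -
  have decomposition: "hc_decomposition n prec u v I th" if "reflection_order n prec" for prec
    using assms that by unfold_locales auto
  have i: "poly_le (Rtilde n u v) (Htilde n u v I th)"
    if "reflection_order n prec" "condE1 n u v I prec" for prec
    using hc_decomposition.Rtilde_le_Htilde[OF decomposition that(2)] that(1) by blast
  have ii: "poly_le (Htilde n u v I th) (Rtilde n u v)"
    if "reflection_order n prec" "condE2 n u v I prec" for prec
    using hc_decomposition.Htilde_le_Rtilde[OF decomposition that(2)] that(1) by blast
  have "Rtilde n u v = Htilde n u v I th"
    if prec: "reflection_order n prec" "condE n u v I prec" for prec
  proof -
    have "condE1 n u v I prec" using prec(2) unfolding condE_def condE1_def by blast
    moreover have "condE2 n u v I prec" using prec(2) unfolding condE_def condE2_def by blast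
    ultimately show ?thesis
      using i[OF prec(1)] ii[OF prec(1)] by (intro poly_eqI) (simp add: poly_le_def order_antisym)
  qed
  with i ii show ?thesis by blast
qed

end
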